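(* Let $\omega$ be the exponent of matrix multiplication over $\mathbb{C}$. (1) If the strong USP capacity equals $3/2^{2/3}$, then $\omega=2$. (2) If for arbitrarily large $n$ there exists a finite abelian group $H$ with $n$ pairs of subsets $A_i,B_i$ satisfying the simultaneous double product property such that $|H|=n^{2+o(1)}$ and $|A_i||B_i|\ge n^{2-o(1)}$ for all $i$, then $\omega=2$.
   Context: The exponent of matrix multiplication $\omega$ (over $\mathbb{C}$) is the smallest real number such that, for each $\varepsilon>0$, $n\times n$ matrix multiplication over $\mathbb{C}$ can be performed in $O(n^{\omega+\varepsilon})$ arithmetic operations. $[k]=\{1,\dots,k\}$. A strong USP of width $k$ is a subset $U\subseteq\{1,2,3\}^k$ such that for all permutations $\pi_1,\pi_2,\pi_3\in\mathrm{Sym}(U)$, either $\pi_1=\pi_2=\pi_3$ or else there exist $u\in U$ and $i\in[k]$ such that exactly two of $(\pi_1(u))_i=1$, $(\pi_2(u))_i=2$, $(\pi_3(u))_i=3$ hold. The strong USP capacity is the largest constant $C$ such that there exist strong USPs of size $(C-o(1))^k$ and width $k$ for infinitely many values of $k$. For a subset $S$ of a group, $Q(S)=\{s_1s_2^{-1}:s_1,s_2\in S\}$. Subsets $S_1,S_2$ of a group satisfy the double product property if $q_1q_2=1$ with $q_i\in Q(S_i)$ implies $q_1=q_2=1$. Pairs of subsets $A_i,B_i$ ($1\le i\le n$) of a group $H$ satisfy the simultaneous double product property if each pair $A_i,B_i$ satisfies the double product property, and for all $i,j,k$, $a_i(a_j')^{-1}b_j(b_k')^{-1}=1$ with $a_i\in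 A_i$, $a_j'\in A_j$, $b_j\in B_j$, $b_k'\in B_k$ implies $i=k$. The $o(1)$ terms are as $n\to\infty$ along the sequence of values of $n$ considered. *)

theory Defs
  imports
    Complex_Main
    "HOL-Library.FuncSet"
    "HOL-Library.Landau_Symbols"
    "HOL-Combinatorics.Permutations"
    "HOL-Algebra.Coset"
    "Jordan_Normal_Form.Matrix"
begin

section \<open>The exponent of matrix multiplication\<close>

text \<open>
  Arithmetic algorithms are straight-line programs over the complex numbers. Every instruction
  is one arithmetic operation whose operands are inputs, earlier results or constants; its result
  is appended to the list of registers. The number of arithmetic operations is therefore the
  length of the program. Division by zero, or use of a register that is not yet there, makes
  the run fail.
\<close>

datatype arith_op = Add | Sub | Mul | Div

datatype operand = Reg nat | Scalar complex

type_synonym program = "(arith_op \<times> operand \<times> operand) list"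

fun operand_value :: "complex list \<Rightarrow> operand \<Rightarrow> complex option" where
  "operand_value rs (Reg i) = (if i < length rs then Some (rs ! i) else None)"
| "operand_value rs (Scalar c) = Some c"

fun apply_op :: "arith_op \<Rightarrow> complex \<Rightarrow> complex \<Rightarrow> complex option" where
  "apply_op Add x y = Some (x + y)"
| "apply_op Sub x y = Some (x - y)"
| "apply_op Mul x y = Some (x * y)"
| "apply_op Div x y = (if y = 0 then None else Some (x / y))"

fun run :: "program \<Rightarrow> complex list \<Rightarrow> complex list option" where
  "run [] rs = Some rs"
| "run ((f, a, b) # p) rs =
     Option.bind (operand_value rs a) (\<lambda>x.
     Option.bind (operand_value rs b) (\<lambda>y.
     Option.bind (apply_op f x y) (\<lambda>z. run p (rs @ [z]))))"

text \<open>
  The input registers hold the entries of the two matrices, row by row; \<open>out i j\<close> says where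
  the entry \<open>(i, j)\<close> of the product is found after the run.
\<close>

definition matmul_input :: "complex mat \<Rightarrow> complex mat \<Rightarrow> complex list" where
  "matmul_input A B = concat (mat_to_list A) @ concat (mat_to_list B)"

definition computes_matmul :: "nat \<Rightarrow> program \<Rightarrow> (nat \<Rightarrow> nat \<Rightarrow> operand) \<Rightarrow> bool" where
  "computes_matmul n p out \<longleftrightarrow>
     (\<forall>A\<in>carrier_mat n n. \<forall>B\<in>carrier_mat n n.
        \<exists>rs. run p (matmul_input A B) = Some rs \<and>
          (\<forall>i<n. \<forall>j<n. operand_value rs (out i j) = Some ((A * B) $$ (i, j))))"

definition matmul_in_O_powr :: "real \<Rightarrow> bool" where
  "matmul_in_O_powr \<tau> \<longleftrightarrow>
     (\<exists>(p :: nat \<Rightarrow> program) out. (\<forall>n. computes_matmul n (p n) (out n)) \<and>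
        (\<lambda>n. real (length (p n))) \<in> O(\<lambda>n. real n powr \<tau>))"

definition matmul_exponent :: real where
  "matmul_exponent = (LEAST w. \<forall>\<epsilon>>0. matmul_in_O_powr (w + \<epsilon>))"


section \<open>Strong uniquely solvable puzzles\<close>

definition exactly_two :: "bool \<Rightarrow> bool \<Rightarrow> bool \<Rightarrow> bool" where
  "exactly_two P Q R \<longleftrightarrow>
     (P \<and> Q \<and> \<not> R) \<or> (P \<and> \<not> Q \<and> R) \<or> (\<not> P \<and> Q \<and> R)"

definition strong_USP :: "nat \<Rightarrow> (nat \<Rightarrow> nat) set \<Rightarrow> bool" where
  "strong_USP k U \<longleftrightarrow>
     U \<subseteq> {1..k} \<rightarrow>\<^sub>E {1, 2, 3} \<and>
     (\<forall>\<pi>1 \<pi>2 \<pi>3. \<pi>1 permutes U \<and> \<pi>2 permutes U \<and> \<pi>3 permutes U \<longrightarrow>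
        (\<pi>1 = \<pi>2 \<and> \<pi>2 = \<pi>3) \<or>
        (\<exists>u\<in>U. \<exists>i\<in>{1..k}. exactly_two (\<pi>1 u i = 1) (\<pi>2 u i = 2) (\<pi>3 u i = 3)))"

text \<open>
  The infinitely many widths are enumerated by a strictly increasing sequence \<open>k\<close>, along which
  the \<open>o(1)\<close> term \<open>e\<close> tends to zero.
\<close>

definition strong_USP_achievable :: "real \<Rightarrow> bool" where
  "strong_USP_achievable C \<longleftrightarrow>
     (\<exists>(k :: nat \<Rightarrow> nat) U (e :: nat \<Rightarrow> real). strict_mono k \<and> e \<longlonglongrightarrow> 0 \<and>
        (\<forall>m. strong_USP (k m) (U m) \<and> real (card (U m)) = (C - e m) ^ k m))"

definition strong_USP_capacity :: real where
  "strong_USP_capacity = (GREATEST C. strong_USP_achievable C)"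


section \<open>The simultaneous double product property\<close>

definition right_quotients :: "('g, 'x) monoid_scheme \<Rightarrow> 'g set \<Rightarrow> 'g set" where
  "right_quotients G S = {s1 \<otimes>\<^bsub>G\<^esub> inv\<^bsub>G\<^esub> s2 | s1 s2. s1 \<in> S \<and> s2 \<in> S}"

definition double_product_property ::
    "('g, 'x) monoid_scheme \<Rightarrow> 'g set \<Rightarrow> 'g set \<Rightarrow> bool" where
  "double_product_property G S1 S2 \<longleftrightarrow>
     (\<forall>q1\<in>right_quotients G S1. \<forall>q2\<in>right_quotients G S2.
        q1 \<otimes>\<^bsub>G\<^esub> q2 = \<one>\<^bsub>G\<^esub> \<longrightarrow> q1 = \<one>\<^bsub>G\<^esub> \<and> q2 = \<one>\<^bsub>G\<^esub>)"

definition simultaneous_double_product_property ::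
    "('g, 'x) monoid_scheme \<Rightarrow> nat \<Rightarrow> (nat \<Rightarrow> 'g set) \<Rightarrow> (nat \<Rightarrow> 'g set) \<Rightarrow> bool" where
  "simultaneous_double_product_property H n A B \<longleftrightarrow>
     (\<forall>i\<in>{1..n}. A i \<subseteq> carrier H \<and> B i \<subseteq> carrier H \<and>
        double_product_property H (A i) (B i)) \<and>
     (\<forall>i\<in>{1..n}. \<forall>j\<in>{1..n}. \<forall>k\<in>{1..n}.
        \<forall>a\<in>A i. \<forall>a'\<in>A j. \<forall>b\<in>B j. \<forall>b'\<in>B k.
          a \<otimes>\<^bsub>H\<^esub> inv\<^bsub>H\<^esub> a' \<otimes>\<^bsub>H\<^esub> b \<otimes>\<^bsub>H\<^esub> inv\<^bsub>H\<^esub> b' = \<one>\<^bsub>H\<^esub> \<longrightarrow> i = k)"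

end

theory Submission
  imports Defs "HOL-Algebra.Product_Groups" "HOL-Algebra.Multiplicative_Group"
begin

text \<open>
  Both parts produce, in a finite abelian group, a family of \<open>N\<close> triples of subsets of sizes
  \<open>a, b, c\<close> with the simultaneous triple product property. Such a family embeds \<open>N\<close> independent
  \<open>a \<times> b \<times> c\<close> matrix products into the group algebra, which the characters diagonalize, so their
  total tensor rank is at most the group order. After symmetrizing to square formats, recursion on
  blocks, in which \<open>N\<close> products at a time are computed simultaneously, shows that
  \<open>|G| \<le> N (a b c)\<^sup>\<sigma>\<^sup>/\<^sup>3\<close> gives \<open>\<omega> \<le> \<sigma>\<close>, up to an arbitrarily small loss for large families.

  The families are indexed by the permutations of a finite set \<open>V\<close>, whose number is about \<open>(|V| / e)\<close>
  to the power \<open>|V|\<close>. For (1), \<open>V\<close> is the puzzle, the group is a power of \<open>\<int>/3\<close>, and the definition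
  of a strong USP is exactly the required uniqueness. For (2), \<open>V\<close> is a triangular array of index
  triples and the group is a power of \<open>H\<close>; uniqueness follows by comparing the sums of the
  coordinates and of their squares over \<open>V\<close>.
\<close>

section \<open>Straight-line computations\<close>

text \<open>The exponent is a \<open>LEAST\<close> over the reals, so an upper bound alone
  determines nothing; the matching lower bound 2 comes from counting output registers. The number of
  permutations sets the numerology. The group is a power with one block of order \<open>g\<close>
  per point of \<open>V\<close>, and a permutation only redistributes the subsets of the blocks, so
  all triples have the same sizes, with product at least \<open>t^|V|\<close>. The inequality for
  the family thus reduces to \<open>g \<le> (|V| / e) t^(\<sigma>/3)\<close>, a condition on a
  single block. For puzzles, \<open>g = 3^k\<close>, \<open>t = 2^k\<close> and \<open>|V|\<close>
  is about \<open>C^k\<close>, which balances at \<sigma> = 2 precisely for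
  \<open>C = 3 / 2^(2/3)\<close>. For pairs, \<open>g = |H|^3\<close> and \<open>t\<close> are about
  \<open>n^6\<close> and \<open>|V|\<close> about \<open>n^2 / 2\<close>, which again balances at
  \<sigma> = 2. Constants such as \<open>e\<close> are absorbed by letting \<sigma> exceed 2. The
  obstacle in the second part is that the simultaneous double product property equates only the
  outer two of its three indices, so no coordinate alone makes three permutations agree. The
  triangular array supplies the rigidity: its points have a fixed coordinate sum, and sums of
  squares detect any deviation.\<close>

text \<open>
  \<open>slp S n T\<close>: starting from the functions \<open>S\<close> of the input registers, \<open>n\<close> operations produce all of \<open>T\<close>.
  Working with sets of functions instead of registers makes costs compose.
\<close>

inductive slp :: "(complex list \<Rightarrow> complex) set \<Rightarrow> nat \<Rightarrow> (complex list \<Rightarrow> complex) set \<Rightarrow> bool"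
  for S where
  slp_refl: "slp S 0 S"
| slp_zero: "slp S n T \<Longrightarrow> slp S (Suc n) (insert (\<lambda>x. 0) T)"
| slp_add: "slp S n T \<Longrightarrow> f \<in> T \<Longrightarrow> g \<in> T \<Longrightarrow> slp S (Suc n) (insert (\<lambda>x. f x + g x) T)"
| slp_mult: "slp S n T \<Longrightarrow> f \<in> T \<Longrightarrow> g \<in> T \<Longrightarrow> slp S (Suc n) (insert (\<lambda>x. f x * g x) T)"
| slp_scale: "slp S n T \<Longrightarrow> f \<in> T \<Longrightarrow> slp S (Suc n) (insert (\<lambda>x. c * f x) T)"

text \<open>The bound on the length and the inclusion in \<open>T\<close> make the notion monotone,
  so that intermediate results can be forgotten.\<close>

definition computes ::
  "(complex list \<Rightarrow> complex) set \<Rightarrow> nat \<Rightarrow> (complex list \<Rightarrow> complex) set \<Rightarrow> bool" where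
  "computes S n F \<longleftrightarrow> (\<exists>m T. m \<le> n \<and> slp S m T \<and> F \<subseteq> T)"

lemma slp_trans: "slp T m V \<Longrightarrow> slp S n T \<Longrightarrow> slp S (n + m) V"
  by (induction rule: slp.induct) (auto intro: slp.intros)

lemma slp_superset: "slp S n T \<Longrightarrow> S \<subseteq> T"
  by (induction rule: slp.induct) auto

lemma slp_mono:
  assumes "slp S n T" "S \<subseteq> S'"
  shows "\<exists>T'. slp S' n T' \<and> T \<subseteq> T' \<and> S' \<subseteq> T'"
  using assms
proof (induction rule: slp.induct)
  case slp_refl
  then show ?case by (auto intro: slp.intros)
next
  case (slp_zero n T)
  then obtain T' where "slp S' n T'" "T \<subseteq> T'" "S' \<subseteq> T'" by auto
  then show ?case by (intro exI[of _ "insert (\<lambda>x. 0) T'"]) (auto intro: slp.intros)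
next
  case (slp_add n T f g)
  then obtain T' where "slp S' n T'" "T \<subseteq> T'" "S' \<subseteq> T'" by auto
  with slp_add.hyps show ?case
    by (intro exI[of _ "insert (\<lambda>x. f x + g x) T'"]) (auto intro: slp.intros)
next
  case (slp_mult n T f g)
  then obtain T' where "slp S' n T'" "T \<subseteq> T'" "S' \<subseteq> T'" by auto
  with slp_mult.hyps show ?case
    by (intro exI[of _ "insert (\<lambda>x. f x * g x) T'"]) (auto intro: slp.intros)
next
  case (slp_scale n T f c)
  then obtain T' where "slp S' n T'" "T \<subseteq> T'" "S' \<subseteq> T'" by auto
  with slp_scale.hyps show ?case
    by (intro exI[of _ "insert (\<lambda>x. c * f x) T'"]) (auto intro: slp.intros)
qed

lemma computes_subset: "F \<subseteq> S \<Longrightarrow> computes S n F"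
  unfolding computes_def by (intro exI[of _ 0] exI[of _ S]) (auto intro: slp.intros)

lemma computes_weaken: "computes S m F \<Longrightarrow> m \<le> n \<Longrightarrow> G \<subseteq> F \<Longrightarrow> computes S n G"
  unfolding computes_def by (meson order_trans)

text \<open>By \<open>slp_mono\<close> the second computation can be replayed on the full register
  set \<open>T\<close> of the first, so the lengths add.\<close>

lemma computes_cut:
  assumes "computes S m F" "computes (S \<union> F) n G"
  shows "computes S (m + n) (F \<union> G)"
proof -
  obtain m' T where T: "m' \<le> m" "slp S m' T" "F \<subseteq> T" using assms(1) by (auto simp: computes_def)
  obtain n' V where V: "n' \<le> n" "slp (S \<union> F) n' V" "G \<subseteq> V"
    using assms(2) by (auto simp: computes_def)
  obtain V' where V': "slp T n' V'" "V \<subseteq> V'" "T \<subseteq> V'"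
    using slp_mono[OF V(2), of T] slp_superset[OF T(2)] T(3) by auto
  show ?thesis unfolding computes_def
    using slp_trans[OF V'(1) T(2)] V' T V by (intro exI[of _ "m' + n'"] exI[of _ V']) auto
qed

lemma computes_mono: "computes S n F \<Longrightarrow> S \<subseteq> S' \<Longrightarrow> computes S' n F"
  unfolding computes_def by (meson slp_mono order_trans)

lemma computes_Un: "computes S m F \<Longrightarrow> computes S n G \<Longrightarrow> computes S (m + n) (F \<union> G)"
  by (auto intro!: computes_cut intro: computes_mono)

lemma computes_UN:
  assumes "finite J" "\<And>j. j \<in> J \<Longrightarrow> computes S c (F j)"
  shows "computes S (card J * c) (\<Union>j\<in>J. F j)"
  using assms
proof (induction J rule: finite_induct)
  case empty
  then show ?case by (auto intro: computes_subset)
next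
  case (insert j J)
  then show ?case using computes_Un[of S c "F j" "card J * c" "\<Union>j\<in>J. F j"] by auto
qed

lemma computes_zero: "computes S 1 {\<lambda>x. 0}"
  unfolding computes_def using slp_zero[OF slp_refl, of S]
  by (intro exI[of _ 1] exI[of _ "insert (\<lambda>x. 0) S"]) auto

lemma computes_add: "f \<in> S \<Longrightarrow> g \<in> S \<Longrightarrow> computes S 1 {\<lambda>x. f x + g x}"
  unfolding computes_def using slp_add[OF slp_refl, of f S g]
  by (intro exI[of _ 1] exI[of _ "insert (\<lambda>x. f x + g x) S"]) auto

lemma computes_mult: "f \<in> S \<Longrightarrow> g \<in> S \<Longrightarrow> computes S 1 {\<lambda>x. f x * g x}"
  unfolding computes_def using slp_mult[OF slp_refl, of f S g]
  by (intro exI[of _ 1] exI[of _ "insert (\<lambda>x. f x * g x) S"]) auto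

lemma computes_scale: "f \<in> S \<Longrightarrow> computes S 1 {\<lambda>x. c * f x}"
  unfolding computes_def using slp_scale[OF slp_refl, of f S c]
  by (intro exI[of _ 1] exI[of _ "insert (\<lambda>x. c * f x) S"]) auto

text \<open>One operation creates the empty sum; every term then costs one scaling and one
  addition.\<close>

lemma computes_lincomb:
  assumes "finite I" "\<And>i. i \<in> I \<Longrightarrow> f i \<in> S"
  shows "computes S (2 * card I + 1) {\<lambda>x. \<Sum>i\<in>I. c i * f i x}"
  using assms
proof (induction I rule: finite_induct)
  case empty
  then show ?case using computes_zero by simp
next
  case (insert i I)
  let ?g = "\<lambda>x. \<Sum>i\<in>I. c i * f i x" and ?h = "\<lambda>x. c i * f i x"
  have "computes S (2 * card I + 1) {?g}" using insert by auto
  moreover have "computes S 1 {?h}" using insert.prems by (intro computes_scale) auto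
  ultimately have "computes S ((2 * card I + 1) + 1) ({?g} \<union> {?h})" by (rule computes_Un)
  moreover have "computes (S \<union> ({?g} \<union> {?h})) 1 {\<lambda>x. ?h x + ?g x}" 
    by (rule computes_add) auto
  ultimately have "computes S (((2 * card I + 1) + 1) + 1) (({?g} \<union> {?h}) \<union> {\<lambda>x. ?h x + ?g x})"
    by (rule computes_cut)
  then show ?case using insert.hyps by (elim computes_weaken) auto
qed

section \<open>Executing straight-line computations as programs\<close>

lemma run_append: "run (p @ q) rs = Option.bind (run p rs) (run q)"
  by (induction p rs rule: run.induct) (auto split: bind_split)

text \<open>One program \<open>p\<close> serves all inputs: every register, initial or new, is
  tracked as a function of the input instead of a value.\<close>

definition realized :: "(complex list \<Rightarrow> complex) list \<Rightarrow> nat \<Rightarrow> (complex list \<Rightarrow> complex) set \<Rightarrow> bool" where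
  "realized fs n T \<longleftrightarrow> (\<exists>p gs. length p = n \<and> T \<subseteq> set (fs @ gs) \<and>
    (\<forall>x. run p (map (\<lambda>f. f x) fs) = Some (map (\<lambda>f. f x) (fs @ gs))))"

lemma register_of_mem:
  assumes "f \<in> set hs"
  shows "\<exists>i. \<forall>x. operand_value (map (\<lambda>f. f x) hs) (Reg i) = Some (f x)"
proof -
  obtain i where "i < length hs" "hs ! i = f" using assms by (meson in_set_conv_nth)
  then show ?thesis by (intro exI[of _ i]) simp
qed

text \<open>The assumption \<open>step\<close> ranges over every register list containing
  \<open>T\<close>, because the order in which registers were filled is not recorded. The operands
  are chosen before \<open>x\<close>, so the new instruction does not depend on the input.\<close>

lemma realized_insert:
  assumes "realized fs n T"
    and step: "\<And>hs. T \<subseteq> set hs \<Longrightarrow> \<exists>a b. \<forall>x.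
      \<exists>u v. operand_value (map (\<lambda>f. f x) hs) a = Some u \<and>
        operand_value (map (\<lambda>f. f x) hs) b = Some v \<and> apply_op op u v = Some (h x)"
  shows "realized fs (Suc n) (insert h T)"
proof -
  obtain p gs where p: "length p = n" "T \<subseteq> set (fs @ gs)"
    "\<And>x. run p (map (\<lambda>f. f x) fs) = Some (map (\<lambda>f. f x) (fs @ gs))"
    using assms(1) unfolding realized_def by blast
  obtain a b where ab: "\<And>x. \<exists>u v. operand_value (map (\<lambda>f. f x) (fs @ gs)) a = Some u \<and>
      operand_value (map (\<lambda>f. f x) (fs @ gs)) b = Some v \<and> apply_op op u v = Some (h x)"
    using step[OF p(2)] by blast
  have "run (p @ [(op, a, b)]) (map (\<lambda>f. f x) fs) = Some (map (\<lambda>f. f x) (fs @ (gs @ [h])))" for x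
    using ab[of x] unfolding run_append p(3) by auto
  then show ?thesis unfolding realized_def using p(1,2)
    by (intro exI[of _ "p @ [(op, a, b)]"] exI[of _ "gs @ [h]"]) auto
qed

lemma realized_slp:
  assumes "slp S n T" "S \<subseteq> set fs"
  shows "realized fs n T"
  using assms
proof (induction rule: slp.induct)
  case slp_refl
  then show ?case unfolding realized_def by (intro exI[of _ "[]"] exI[of _ "[]"]) auto
next
  case (slp_zero n T)
  \<comment> \<open>Zero is obtained as the sum of two scalar operands 0.\<close>
  then show ?case
    by (intro realized_insert[where op = Add]) (auto intro!: exI[of _ "Scalar 0"])
next
  case (slp_add n T f g)
  from slp_add.IH[OF slp_add.prems] show ?case
  proof (rule realized_insert[where op = Add])
    fix hs assume "T \<subseteq> set hs"
    then have "f \<in> set hs" "g \<in> set hs"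
      using slp_add.hyps by auto
    then show "\<exists>a b. \<forall>x. \<exists>u v. operand_value (map (\<lambda>f. f x) hs) a = Some u \<and>
        operand_value (map (\<lambda>f. f x) hs) b = Some v \<and> apply_op Add u v = Some (f x + g x)"
      using register_of_mem[of f hs] register_of_mem[of g hs] by (metis apply_op.simps(1))
  qed
next
  case (slp_mult n T f g)
  from slp_mult.IH[OF slp_mult.prems] show ?case
  proof (rule realized_insert[where op = Mul])
    fix hs assume "T \<subseteq> set hs"
    then have "f \<in> set hs" "g \<in> set hs"
      using slp_mult.hyps by auto
    then show "\<exists>a b. \<forall>x. \<exists>u v. operand_value (map (\<lambda>f. f x) hs) a = Some u \<and>
        operand_value (map (\<lambda>f. f x) hs) b = Some v \<and> apply_op Mul u v = Some (f x * g x)"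
      using register_of_mem[of f hs] register_of_mem[of g hs] by (metis apply_op.simps(3))
  qed
next
  case (slp_scale n T f c)
  from slp_scale.IH[OF slp_scale.prems] show ?case
  proof (rule realized_insert[where op = Mul])
    fix hs assume "T \<subseteq> set hs"
    then have "f \<in> set hs" using slp_scale.hyps by auto
    then show "\<exists>a b. \<forall>x. \<exists>u v. operand_value (map (\<lambda>f. f x) hs) a = Some u \<and>
        operand_value (map (\<lambda>f. f x) hs) b = Some v \<and> apply_op Mul u v = Some (c * f x)"
      using register_of_mem[of f hs] by (metis apply_op.simps(3) operand_value.simps(2))
  qed
qed

section \<open>From bilinear algorithms to programs\<close>

text \<open>
  \<open>bilinear_mm N q R\<close>: the direct sum of \<open>N\<close> copies of \<open>q \<times> q\<close> matrix multiplication has tensor rank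
  at most \<open>R\<close>.
\<close>

definition bilinear_mm :: "nat \<Rightarrow> nat \<Rightarrow> nat \<Rightarrow> bool" where
  "bilinear_mm N q R \<longleftrightarrow>
     (\<exists>(\<alpha> :: nat \<Rightarrow> nat \<times> nat \<times> nat \<Rightarrow> complex) \<beta> \<gamma>.
        \<forall>u v. \<forall>t<N. \<forall>i<q. \<forall>j<q.
          (\<Sum>r<R. \<gamma> r (t, i, j) *
             ((\<Sum>z\<in>{..<N} \<times> {..<q} \<times> {..<q}. \<alpha> r z * u z) *
              (\<Sum>z\<in>{..<N} \<times> {..<q} \<times> {..<q}. \<beta> r z * v z))) =
          (\<Sum>k<q. u (t, i, k) * v (t, k, j)))"

lemma bilinear_mm_mono:
  assumes "bilinear_mm N q R" "R \<le> R'"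
  shows "bilinear_mm N q R'"
proof -
  let ?Z = "{..<N} \<times> {..<q} \<times> {..<q}"
  obtain \<alpha> \<beta> \<gamma> where *: "\<And>u v t i j. t < N \<Longrightarrow> i < q \<Longrightarrow> j < q \<Longrightarrow>
      (\<Sum>r<R. \<gamma> r (t, i, j) * ((\<Sum>z\<in>?Z. \<alpha> r z * u z) * (\<Sum>z\<in>?Z. \<beta> r z * v z))) =
      (\<Sum>k<q. u (t, i, k) * v (t, k, j) :: complex)"
    using assms(1) unfolding bilinear_mm_def by blast
  have "(\<Sum>r<R'. (if r < R then \<gamma> r (t, i, j) else 0) *
          ((\<Sum>z\<in>?Z. \<alpha> r z * u z) * (\<Sum>z\<in>?Z. \<beta> r z * v z))) =
      (\<Sum>r<R. \<gamma> r (t, i, j) * ((\<Sum>z\<in>?Z. \<alpha> r z * u z) * (\<Sum>z\<in>?Z. \<beta> r z * v z)))" for t i j u v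
    using assms(2) by (intro sum.mono_neutral_cong_right) auto
  then show ?thesis unfolding bilinear_mm_def
    by (intro exI[of _ \<alpha>] exI[of _ \<beta>] exI[of _ "\<lambda>r z. if r < R then \<gamma> r z else 0"]) (simp add: *)
qed

text \<open>Entries are arbitrary available functions, not just input registers, so that the
  recursion can feed in linear combinations of blocks.\<close>

definition multi_mm :: "nat \<Rightarrow> nat \<Rightarrow> nat \<Rightarrow> bool" where
  "multi_mm N d L \<longleftrightarrow>
     (\<forall>S a b. (\<forall>t<N. \<forall>i<d. \<forall>j<d. a t i j \<in> S \<and> b t i j \<in> S) \<longrightarrow>
        computes S L {\<lambda>x. \<Sum>k<d. a t i k x * b t k j x | t i j. t < N \<and> i < d \<and> j < d})"

lemma sum_lessThan_times:
  fixes f :: "nat \<Rightarrow> 'a::comm_monoid_add"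
  shows "(\<Sum>k<q * d. f k) = (\<Sum>k1<q. \<Sum>k0<d. f (k1 * d + k0))"
proof -
  have "(\<Sum>k1<q. \<Sum>k0<d. f (k1 * d + k0)) = (\<Sum>k1<q. sum f {k1 * d..<k1 * d + d})"
  proof (rule sum.cong)
    fix k1 show "(\<Sum>k0<d. f (k1 * d + k0)) = sum f {k1 * d..<k1 * d + d}"
      by (rule sum.reindex_bij_witness[of _ "\<lambda>k. k - k1 * d" "\<lambda>k. k1 * d + k"]) auto
  qed simp
  then show ?thesis by (simp add: sum.nat_group)
qed

lemma block_index_less: "i < q \<Longrightarrow> i0 < d \<Longrightarrow> i * d + i0 < q * (d::nat)"
proof -
  assume "i < q" "i0 < d"
  then have "i * d + i0 < Suc i * d" by simp
  also have "\<dots> \<le> q * d" using \<open>i < q\<close> by (intro mult_le_mono1) auto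
  finally show ?thesis .
qed

text \<open>
  One level of recursion: the \<open>K N\<close> block products required by the bilinear algorithm are handled
  in \<open>K\<close> batches of \<open>N\<close>, which makes \<open>K\<close> rather than \<open>K N\<close> the growth rate.
\<close>

lemma multi_mm_block:
  assumes bil: "bilinear_mm N q (K * N)"
  shows "\<exists>c. \<forall>d L. multi_mm N d L \<longrightarrow> multi_mm N (q * d) (K * L + c * d\<^sup>2)"
proof -
  let ?Z = "{..<N} \<times> {..<q} \<times> {..<q}"
  let ?c1 = "2 * card ?Z + 1"
  obtain \<alpha> \<beta> \<gamma> where *: "\<And>u v t i j. t < N \<Longrightarrow> i < q \<Longrightarrow> j < q \<Longrightarrow>
      (\<Sum>r<K * N. \<gamma> r (t, i, j) * ((\<Sum>z\<in>?Z. \<alpha> r z * u z) * (\<Sum>z\<in>?Z. \<beta> r z * v z))) =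
      (\<Sum>k<q. u (t, i, k) * v (t, k, j) :: complex)"
    using bil unfolding bilinear_mm_def by blast
  \<comment> \<open>Per position inside a block: \<open>K * N\<close> linear combinations of blocks
    on each side at cost \<open>?c1\<close>, and \<open>N * q * q\<close> output combinations of
    \<open>K * N\<close> products.\<close>
  define c where "c = 2 * (K * N * ?c1) + N * q * q * (2 * (K * N) + 1)"
  have "multi_mm N (q * d) (K * L + c * d\<^sup>2)" if mm: "multi_mm N d L" for d L
    unfolding multi_mm_def
  proof (intro allI impI)
    fix S :: "(complex list \<Rightarrow> complex) set" and a b
    assume "\<forall>t<N. \<forall>i<q * d. \<forall>j<q * d. a t i j \<in> S \<and> b t i j \<in> S"
    then have ab: "t < N \<Longrightarrow> i < q * d \<Longrightarrow> j < q * d \<Longrightarrow> a t i j \<in> S \<and> b t i j \<in> S" for t i j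
      by blast
    define la where "la r i0 k0 = (\<lambda>x. \<Sum>z\<in>?Z. \<alpha> r z *
      (case z of (t, i, k) \<Rightarrow> a t (i * d + i0) (k * d + k0)) x)" for r i0 k0
    define lb where "lb r k0 j0 = (\<lambda>x. \<Sum>z\<in>?Z. \<beta> r z *
      (case z of (t, k, j) \<Rightarrow> b t (k * d + k0) (j * d + j0)) x)" for r k0 j0
    define pr where "pr r i0 j0 = (\<lambda>x. \<Sum>k0<d. la r i0 k0 x * lb r k0 j0 x)" for r i0 j0
    define J where "J = {..<K * N} \<times> {..<d} \<times> {..<d}"
    define FA where "FA = (\<Union>(r, i0, k0)\<in>J. {la r i0 k0})"
    define FB where "FB = (\<Union>(r, i0, k0)\<in>J. {lb r i0 k0})"
    \<comment> \<open>Product number \<open>r\<close> is found in batch \<open>r div N\<close> at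
      place \<open>r mod N\<close>.\<close>
    define P where "P = (\<Union>l<K. {\<lambda>x. \<Sum>k0<d. la (l * N + t) i0 k0 x * lb (l * N + t) k0 j0 x | t i0 j0.
       t < N \<and> i0 < d \<and> j0 < d})"
    define J' where "J' = {..<N} \<times> {..<q * d} \<times> {..<q * d}"
    define out where "out t i j = (\<lambda>x. \<Sum>r<K * N. \<gamma> r (t, i div d, j div d) * pr r (i mod d) (j mod d) x)"
      for t i j
    have "computes S (card J * ?c1) FA" unfolding FA_def
    proof (rule computes_UN)
      fix z assume "z \<in> J"
      then obtain r i0 k0 where "z = (r, i0, k0)" "i0 < d" "k0 < d" by (auto simp: J_def)
      then show "computes S ?c1 (case z of (r, i0, k0) \<Rightarrow> {la r i0 k0})"
        unfolding la_def using ab block_index_less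
        by (simp only: prod.case, intro computes_lincomb) auto
    qed (simp add: J_def)
    moreover have "computes S (card J * ?c1) FB" unfolding FB_def
    proof (rule computes_UN)
      fix z assume "z \<in> J"
      then obtain r k0 j0 where "z = (r, k0, j0)" "k0 < d" "j0 < d" by (auto simp: J_def)
      then show "computes S ?c1 (case z of (r, k0, j0) \<Rightarrow> {lb r k0 j0})"
        unfolding lb_def using ab block_index_less
        by (simp only: prod.case, intro computes_lincomb) auto
    qed (simp add: J_def)
    ultimately have 1: "computes S (card J * ?c1 + card J * ?c1) (FA \<union> FB)"
      by (rule computes_Un)
    have mem: "la r i j \<in> FA" "lb r i j \<in> FB" if "r < K * N" "i < d" "j < d" for r i j
      using that unfolding FA_def FB_def J_def by (intro UN_I[of "(r, i, j)"]; simp)+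
    have "computes (S \<union> (FA \<union> FB)) (card {..<K} * L) P" unfolding P_def
    proof (rule computes_UN)
      fix l assume l: "l \<in> {..<K}"
      have "(\<forall>t<N. \<forall>i<d. \<forall>j<d. la (l * N + t) i j \<in> S \<union> (FA \<union> FB) \<and>
                lb (l * N + t) i j \<in> S \<union> (FA \<union> FB))"
        using l mem block_index_less[of l K] by blast
      then show "computes (S \<union> (FA \<union> FB)) L
          {\<lambda>x. \<Sum>k0<d. la (l * N + t) i0 k0 x * lb (l * N + t) k0 j0 x | t i0 j0. t < N \<and> i0 < d \<and> j0 < d}"
        using mm[unfolded multi_mm_def, rule_format,
           of "\<lambda>t. la (l * N + t)" "S \<union> (FA \<union> FB)" "\<lambda>t. lb (l * N + t)"] by simp
    qed auto
    then have 2: "computes (S \<union> (FA \<union> FB)) (K * L) P" by simp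
    have prP: "pr r i0 j0 \<in> P" if "r < K * N" "i0 < d" "j0 < d" for r i0 j0
    proof -
      have "N > 0" using that by (cases N) auto
      moreover have "r div N < K" using that(1) by (simp add: less_mult_imp_div_less)
      moreover have "pr r i0 j0 = (\<lambda>x. \<Sum>k0<d. la (r div N * N + r mod N) i0 k0 x * lb (r div N * N + r mod N) k0 j0 x)"
        by (simp add: pr_def)
      ultimately show ?thesis using that unfolding P_def
        by (intro UN_I[of "r div N"] CollectI exI[of _ "r mod N"] exI[of _ i0] exI[of _ j0]) simp_all
    qed
    have 4: "computes ((S \<union> (FA \<union> FB)) \<union> P) (card J' * (2 * card {..<K * N} + 1)) (\<Union>(t, i, j)\<in>J'. {out t i j})"
    proof (rule computes_UN)
      fix z assume "z \<in> J'"
      then obtain t i j where z: "z = (t, i, j)" "t < N" "i < q * d" "j < q * d" by (auto simp: J'_def)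
      then have "d > 0" by (cases d) auto
      then show "computes ((S \<union> (FA \<union> FB)) \<union> P) (2 * card {..<K * N} + 1) (case z of (t, i, j) \<Rightarrow> {out t i j})"
        unfolding z(1) prod.case out_def
        by (intro computes_lincomb) (auto intro!: prP)
    qed (simp add: J'_def)
    have 3: "computes S (card J * ?c1 + card J * ?c1 + K * L + card J' * (2 * card {..<K * N} + 1))
      (FA \<union> FB \<union> P \<union> (\<Union>(t, i, j)\<in>J'. {out t i j}))" using computes_cut[OF computes_cut[OF 1 2]] 4 by (simp add: Un_assoc)
    have out: "out t i j = (\<lambda>x. \<Sum>k<q * d. a t i k x * b t k j x)" if "t < N" "i < q * d" "j < q * d" for t i j
    proof
      fix x
      define i1 i0 j1 j0 where "i1 = i div d" "i0 = i mod d" "j1 = j div d" "j0 = j mod d"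
      have ij: "i = i1 * d + i0" "j = j1 * d + j0" by (auto simp: i1_i0_j1_j0_def)
      have "d > 0" using that by (cases d) auto
      then have l: "i1 < q" "j1 < q" using that by (auto simp: i1_i0_j1_j0_def less_mult_imp_div_less)
      have "out t i j x = (\<Sum>r<K * N. \<gamma> r (t, i1, j1) * (\<Sum>k0<d. la r i0 k0 x * lb r k0 j0 x))"
        by (simp add: out_def pr_def i1_i0_j1_j0_def)
      also have "\<dots> = (\<Sum>r<K * N. \<Sum>k0<d. \<gamma> r (t, i1, j1) * (la r i0 k0 x * lb r k0 j0 x))"
        by (simp add: sum_distrib_left)
      \<comment> \<open>With \<open>k0\<close> outermost everything inside is scalar, so the
        bilinear identity applies for each fixed \<open>k0\<close>, to the entries at offsets
        \<open>(i0, k0)\<close> and \<open>(k0, j0)\<close> of the blocks.\<close>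
      also have "\<dots> = (\<Sum>k0<d. \<Sum>r<K * N. \<gamma> r (t, i1, j1) * (la r i0 k0 x * lb r k0 j0 x))"
        by (rule sum.swap)
      also have "\<dots> = (\<Sum>k0<d. \<Sum>k<q. a t (i1 * d + i0) (k * d + k0) x * b t (k * d + k0) (j1 * d + j0) x)"
        unfolding la_def lb_def
        by (rule sum.cong[OF refl], subst *) (use that l in auto)
      also have "\<dots> = (\<Sum>k<q. \<Sum>k0<d. a t i (k * d + k0) x * b t (k * d + k0) j x)"
        unfolding ij by (rule sum.swap)
      finally show "out t i j x = (\<Sum>k<q * d. a t i k x * b t k j x)"
        by (simp add: sum_lessThan_times)
    qed
    show "computes S (K * L + c * d\<^sup>2)
        {\<lambda>x. \<Sum>k<q * d. a t i k x * b t k j x | t i j. t < N \<and> i < q * d \<and> j < q * d}"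
    proof (rule computes_weaken[OF 3])
      show "{\<lambda>x. \<Sum>k<q * d. a t i k x * b t k j x | t i j. t < N \<and> i < q * d \<and> j < q * d} \<subseteq>
        FA \<union> FB \<union> P \<union> (\<Union>(t, i, j)\<in>J'. {out t i j})"
      proof
        fix f assume "f \<in> {\<lambda>x. \<Sum>k<q * d. a t i k x * b t k j x | t i j. t < N \<and> i < q * d \<and> j < q * d}"
        then obtain t i j where "f = out t i j" "t < N" "i < q * d" "j < q * d" using out by auto
        then have "f \<in> (\<Union>(t, i, j)\<in>J'. {out t i j})" by (auto simp: J'_def)
        then show "f \<in> FA \<union> FB \<union> P \<union> (\<Union>(t, i, j)\<in>J'. {out t i j})" by blast
      qed
    qed (simp add: c_def J_def J'_def algebra_simps power2_eq_square)
  qed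
  then show ?thesis by blast
qed

lemma multi_mm_1: "multi_mm N 1 N"
  unfolding multi_mm_def
proof (intro allI impI)
  fix S :: "(complex list \<Rightarrow> complex) set" and a b :: "nat \<Rightarrow> nat \<Rightarrow> nat \<Rightarrow> complex list \<Rightarrow> complex"
  assume "\<forall>t<N. \<forall>i<1. \<forall>j<1. a t i j \<in> S \<and> b t i j \<in> S"
  then have "computes S (card {..<N} * 1) (\<Union>t\<in>{..<N}. {\<lambda>x. a t 0 0 x * b t 0 0 x})"
    by (intro computes_UN computes_mult) auto
  then show "computes S N {\<lambda>x. \<Sum>k<1. a t i k x * b t k j x | t i j. t < N \<and> i < 1 \<and> j < 1}"
    by (elim computes_weaken) auto
qed

lemma multi_mm_mono:
  assumes "multi_mm N d L" "L \<le> L'"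
  shows "multi_mm N d L'"
  unfolding multi_mm_def
proof (intro allI impI, rule computes_weaken[OF _ assms(2) order_refl])
qed (use assms(1) in \<open>simp add: multi_mm_def\<close>)

text \<open>Since \<open>K \<ge> q^2 + 1\<close>, the overhead can be carried in the invariant:
  \<open>c q^(2h)\<close> together with the next \<open>c q^(2h+2)\<close> is at most
  \<open>K\<close> times \<open>c q^(2h)\<close>. The total is therefore of order
  \<open>K ^ h\<close> without further loss.\<close>

lemma multi_mm_power:
  assumes bil: "bilinear_mm N q (K * N)" and K: "K > q\<^sup>2"
  shows "\<exists>C. \<forall>h. multi_mm N (q ^ h) (C * K ^ h)"
proof -
  obtain c where c: "\<And>d L. multi_mm N d L \<Longrightarrow> multi_mm N (q * d) (K * L + c * d\<^sup>2)"
    using multi_mm_block[OF bil] by blast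
  have "\<exists>L. multi_mm N (q ^ h) L \<and> L + c * (q ^ h)\<^sup>2 \<le> (N + c) * K ^ h" for h
  proof (induction h)
    case 0
    then show ?case using multi_mm_1 by (intro exI[of _ N]) auto
  next
    case (Suc h)
    then obtain L where L: "multi_mm N (q ^ h) L" "L + c * (q ^ h)\<^sup>2 \<le> (N + c) * K ^ h" by blast
    have "K * L + c * (q ^ h)\<^sup>2 + c * (q ^ Suc h)\<^sup>2 = K * L + (c * (q ^ h)\<^sup>2) * (q\<^sup>2 + 1)"
      by (simp add: algebra_simps power_mult_distrib)
    also have "\<dots> \<le> K * L + (c * (q ^ h)\<^sup>2) * K" using K by (intro add_mono mult_mono) auto
    also have "\<dots> = K * (L + c * (q ^ h)\<^sup>2)" by (simp add: algebra_simps)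
    also have "\<dots> \<le> K * ((N + c) * K ^ h)" using L by (intro mult_mono) auto
    finally show ?case using c[OF L(1)]
      by (intro exI[of _ "K * L + c * (q ^ h)\<^sup>2"]) (simp add: algebra_simps)
  qed
  then show ?thesis by (meson add_leD1 multi_mm_mono)
qed


section \<open>From block recursion to matrices of every size\<close>

lemma length_concat_rows: "length (concat (map (\<lambda>i. map (f i) [0..<n]) [0..<m])) = m * n"
  by (induction m) auto

lemma nth_concat_rows:
  "i < m \<Longrightarrow> j < n \<Longrightarrow> concat (map (\<lambda>i. map (f i) [0..<n]) [0..<m]) ! (i * n + j) = f i j"
proof (induction m)
  case (Suc m)
  then show ?case
    by (cases "i = m") (auto simp: nth_append length_concat_rows block_index_less)
qed simp

lemma matmul_input_eq:
  assumes "A \<in> carrier_mat n n" "B \<in> carrier_mat n n"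
  shows "matmul_input A B =
    concat (map (\<lambda>i. map (\<lambda>j. A $$ (i, j)) [0..<n]) [0..<n]) @
    concat (map (\<lambda>i. map (\<lambda>j. B $$ (i, j)) [0..<n]) [0..<n])"
  using assms by (simp add: matmul_input_def mat_to_list_def)

lemma length_matmul_input:
  assumes "A \<in> carrier_mat n n" "B \<in> carrier_mat n n"
  shows "length (matmul_input A B) = 2 * (n * n)"
  by (simp add: matmul_input_eq[OF assms] length_concat_rows)

lemma nth_matmul_input:
  assumes "A \<in> carrier_mat n n" "B \<in> carrier_mat n n" "i < n" "j < n"
  shows "matmul_input A B ! (i * n + j) = A $$ (i, j)"
    and "matmul_input A B ! (n * n + i * n + j) = B $$ (i, j)"
proof -
  show "matmul_input A B ! (i * n + j) = A $$ (i, j)"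
    using assms(3,4)
    by (simp add: matmul_input_eq[OF assms(1,2)] nth_append length_concat_rows block_index_less nth_concat_rows)
  show "matmul_input A B ! (n * n + i * n + j) = B $$ (i, j)"
    using assms(3,4) nth_concat_rows[of i n j n "\<lambda>i j. B $$ (i, j)"]
    by (simp add: matmul_input_eq[OF assms(1,2)] nth_append length_concat_rows)
qed

text \<open>The matrices are padded with zeros to size \<open>d\<close>, and the same pair fills all
  \<open>N\<close> slots; the additional operation creates the zero used for padding.\<close>

lemma computes_matmul_of_multi_mm:
  assumes mm: "multi_mm N d L" and "N > 0" "n \<le> d"
  shows "\<exists>p out. computes_matmul n p out \<and> length p \<le> L + 1"
proof -
  define fs :: "(complex list \<Rightarrow> complex) list" where "fs = map (\<lambda>i xs. xs ! i) [0..<2 * (n * n)]"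
  define a :: "nat \<Rightarrow> nat \<Rightarrow> complex list \<Rightarrow> complex" where
    "a i j = (if i < n \<and> j < n then (\<lambda>xs. xs ! (i * n + j)) else (\<lambda>x. 0))" for i j
  define b :: "nat \<Rightarrow> nat \<Rightarrow> complex list \<Rightarrow> complex" where
    "b i j = (if i < n \<and> j < n then (\<lambda>xs. xs ! (n * n + i * n + j)) else (\<lambda>x. 0))" for i j
  let ?F = "{\<lambda>x. \<Sum>k<d. a i k x * b k j x | t i j. t < N \<and> i < d \<and> j < d}"
  have "(\<lambda>xs. xs ! l) \<in> set fs" if "l < 2 * (n * n)" for l
    using that by (auto simp: fs_def)
  moreover have "i * n + j < 2 * (n * n)" "n * n + i * n + j < 2 * (n * n)" if "i < n" "j < n" for i j
    using block_index_less[OF that] by auto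
  ultimately have mem: "a i j \<in> set fs \<union> {\<lambda>x. 0} \<and> b i j \<in> set fs \<union> {\<lambda>x. 0}" for i j
    unfolding a_def b_def by auto
  have "computes (set fs \<union> {\<lambda>x. 0}) L ?F"
    using mm[unfolded multi_mm_def, rule_format, of "\<lambda>t. a" "set fs \<union> {\<lambda>x. 0}" "\<lambda>t. b"] mem by auto
  from computes_cut[OF computes_zero this] 
  obtain m T where T: "m \<le> 1 + L" "slp (set fs) m T" "?F \<subseteq> T"
    unfolding computes_def by auto
  obtain p gs where p: "length p = m" "T \<subseteq> set (fs @ gs)"
    "\<And>x. run p (map (\<lambda>f. f x) fs) = Some (map (\<lambda>f. f x) (fs @ gs))"
    using realized_slp[OF T(2) order_refl] unfolding realized_def by auto
  have ex: "\<exists>r. \<forall>x. operand_value (map (\<lambda>f. f x) (fs @ gs)) r = Some (\<Sum>k<d. a i k x * b k j x)"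
    if "i < n" "j < n" for i j
  proof -
    have "(\<lambda>x. \<Sum>k<d. a i k x * b k j x) \<in> ?F"
      using that assms(2,3) less_le_trans by blast
    then have "(\<lambda>x. \<Sum>k<d. a i k x * b k j x) \<in> set (fs @ gs)" using T(3) p(2) by (meson subsetD)
    then show ?thesis using register_of_mem[of "\<lambda>x. \<Sum>k<d. a i k x * b k j x" "fs @ gs"] by blast
  qed
  define out where "out i j =
    (SOME r. \<forall>x. operand_value (map (\<lambda>f. f x) (fs @ gs)) r = Some (\<Sum>k<d. a i k x * b k j x))" for i j
  have out: "operand_value (map (\<lambda>f. f x) (fs @ gs)) (out i j) = Some (\<Sum>k<d. a i k x * b k j x)"
    if "i < n" "j < n" for i j x
    using someI_ex[OF ex[OF that]] unfolding out_def by blast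
  have "computes_matmul n p out"
    unfolding computes_matmul_def
  proof (intro ballI)
    fix A B :: "complex mat" assume AB: "A \<in> carrier_mat n n" "B \<in> carrier_mat n n"
    let ?x = "matmul_input A B"
    have "map (\<lambda>f. f ?x) fs = ?x"
      using map_nth[of ?x] by (simp add: fs_def length_matmul_input[OF AB] comp_def)
    moreover have "(\<Sum>k<d. a i k ?x * b k j ?x) = (A * B) $$ (i, j)" if ij: "i < n" "j < n" for i j
    proof -
      have "(\<Sum>k<d. a i k ?x * b k j ?x) = (\<Sum>k<n. A $$ (i, k) * B $$ (k, j))"
        using \<open>n \<le> d\<close> ij
        by (intro sum.mono_neutral_cong_right) (auto simp: a_def b_def nth_matmul_input[OF AB])
      also have "\<dots> = (A * B) $$ (i, j)"
        using AB ij by (simp add: scalar_prod_def atLeast0LessThan)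
      finally show ?thesis .
    qed
    ultimately show "\<exists>rs. run p ?x = Some rs \<and>
        (\<forall>i<n. \<forall>j<n. operand_value rs (out i j) = Some ((A * B) $$ (i, j)))"
      using p(3)[of ?x] out[of _ _ ?x] by (intro exI[of _ "map (\<lambda>f. f ?x) (fs @ gs)"]) simp
  qed
  then show ?thesis using T(1) p(1) by auto
qed

text \<open>Rounding \<open>n\<close> up to a power of \<open>q\<close> loses at most a factor
  \<open>q\<close> in the size, hence the factor \<open>q powr \<tau>\<close> in the
  constant.\<close>

lemma matmul_in_O_powr_of_bilinear_mm:
  assumes bil: "bilinear_mm N q (K * N)" and "N > 0" "q \<ge> 2" "K > q\<^sup>2"
    and K: "real K \<le> real q powr \<tau>" and "\<tau> > 0"
  shows "matmul_in_O_powr \<tau>"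
proof -
  obtain C where C: "\<And>h. multi_mm N (q ^ h) (C * K ^ h)"
    using multi_mm_power[OF bil assms(4)] by blast
  \<comment> \<open>For \<open>n = 0\<close> the right-hand side is 0, as
    \<open>0 powr \<tau> = 0\<close>, so the bound starts at 1.\<close>
  have "\<exists>p out. computes_matmul n p out \<and>
      (n \<ge> 1 \<longrightarrow> real (length p) \<le> (C * real q powr \<tau> + 1) * real n powr \<tau>)" for n
  proof -
    define h where "h = (LEAST h. n \<le> q ^ h)"
    have "n < 2 ^ n" by (rule less_exp)
    also have "(2::nat) ^ n \<le> q ^ n" using \<open>q \<ge> 2\<close> by (intro power_mono) auto
    finally have ex: "n \<le> q ^ n" by simp
    then have h: "n \<le> q ^ h" unfolding h_def by (rule LeastI)
    have h': "q ^ h \<le> q * n" if "n \<ge> 1"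
    proof (cases h)
      case 0
      then show ?thesis using that \<open>q \<ge> 2\<close> by simp
    next
      case (Suc h')
      then have "\<not> n \<le> q ^ h'" using not_less_Least[of h' "\<lambda>h. n \<le> q ^ h"] unfolding h_def by auto
      then show ?thesis using Suc by simp
    qed
    obtain p out where p: "computes_matmul n p out" "length p \<le> C * K ^ h + 1"
      using computes_matmul_of_multi_mm[OF C \<open>N > 0\<close> h] by blast
    have "real (length p) \<le> (C * real q powr \<tau> + 1) * real n powr \<tau>" if "n \<ge> 1"
    proof -
      have "real K ^ h \<le> (real q powr \<tau>) ^ h" using K by (intro power_mono) auto
      also have "\<dots> = (real q ^ h) powr \<tau>" using \<open>q \<ge> 2\<close>
        by (simp add: powr_powr mult.commute flip: powr_realpow)
      also have "\<dots> \<le> (real q * real n) powr \<tau>"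
        using h'[OF that] \<open>\<tau> > 0\<close> by (intro powr_mono2) (auto simp flip: of_nat_power of_nat_mult)
      also have "\<dots> = real q powr \<tau> * real n powr \<tau>" by (simp add: powr_mult)
      finally have "C * real K ^ h \<le> C * (real q powr \<tau> * real n powr \<tau>)" by (intro mult_left_mono) auto
      moreover have "1 \<le> real n powr \<tau>" using that \<open>\<tau> > 0\<close> by (simp add: ge_one_powr_ge_zero)
      moreover have "real (length p) \<le> C * real K ^ h + 1"
        using p(2) by (simp flip: of_nat_power of_nat_mult)
      ultimately show ?thesis by (simp add: algebra_simps)
    qed
    then show ?thesis using p(1) by blast
  qed
  then obtain p out where p: "\<And>n. computes_matmul n (p n) (out n)"
    "\<And>n. n \<ge> 1 \<Longrightarrow> real (length (p n)) \<le> (C * real q powr \<tau> + 1) * real n powr \<tau>"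
    by metis
  have "(\<lambda>n. real (length (p n))) \<in> O(\<lambda>n. real n powr \<tau>)"
    by (rule bigoI[of _ "C * real q powr \<tau> + 1"])
       (use p(2) in \<open>auto intro!: eventually_mono[OF eventually_ge_at_top[of 1]]\<close>)
  then show ?thesis unfolding matmul_in_O_powr_def using p(1) by blast
qed

section \<open>The exponent is at least 2\<close>

lemma run_extends: "run p rs = Some rs' \<Longrightarrow> \<exists>zs. rs' = rs @ zs \<and> length zs = length p"
  by (induction p rs arbitrary: rs' rule: run.induct) (fastforce split: bind_splits)+

text \<open>Each output needs a register of its own beyond the inputs. A scalar cannot be both 0 and
  \<open>n\<close>; an input register holds 1 when its own matrix is all ones, although the product
  vanishes if the other matrix is zero; and two outputs in one register are told apart by a row of
  ones times a column of ones.\<close>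

lemma computes_matmul_length_ge:
  assumes p: "computes_matmul n p out"
  shows "n * n \<le> length p"
proof -
  define E where "E i j = mat n n (\<lambda>(a, b). if i a \<and> j b then 1 else 0 :: complex)" for i j
  define Z where "Z = mat n n (\<lambda>_. 0 :: complex)"
  define J where "J = mat n n (\<lambda>_. 1 :: complex)"
  define I where "I = {..<n} \<times> {..<n}"
  have carr: "E i j \<in> carrier_mat n n" "Z \<in> carrier_mat n n" "J \<in> carrier_mat n n" for i j
    by (auto simp: E_def Z_def J_def)
  have val: "\<exists>zs. length zs = length p \<and>
      operand_value (matmul_input A B @ zs) (out i j) = Some ((A * B) $$ (i, j))"
    if "A \<in> carrier_mat n n" "B \<in> carrier_mat n n" "i < n" "j < n" for A B i j
    using p that unfolding computes_matmul_def by (metis run_extends)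
  have JJ: "(J * J) $$ (i, j) = of_nat n" "(Z * J) $$ (i, j) = 0" "(J * Z) $$ (i, j) = 0"
    "(Z * Z) $$ (i, j) = 0" if "i < n" "j < n" for i j
    using that by (auto simp: J_def Z_def scalar_prod_def)
  have ex: "\<exists>r. out i j = Reg r \<and> 2 * (n * n) \<le> r \<and> r < 2 * (n * n) + length p" if ij: "i < n" "j < n" for i j
  proof (cases "out i j")
    case (Scalar c)
    then have "c = 0" "c = of_nat n"
      using val[OF carr(2,2) ij] val[OF carr(3,3) ij] JJ[OF ij] by auto
    then show ?thesis using ij by auto
  next
    case (Reg r)
    have "r < 2 * (n * n) + length p"
      using val[OF carr(2,2) ij] Reg by (auto simp: length_matmul_input[OF carr(2,2)] split: if_splits)
    moreover have "\<not> r < 2 * (n * n)"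
    proof
      assume r: "r < 2 * (n * n)"
      have "n > 0" using ij by auto
      have in0: "matmul_input A B ! r = (A * B) $$ (i, j)"
        if "A \<in> carrier_mat n n" "B \<in> carrier_mat n n" for A B
        using val[OF that ij] Reg r by (auto simp: nth_append length_matmul_input[OF that] split: if_splits)
      show False
      proof (cases "r < n * n")
        case True
        have "r div n < n" "r mod n < n" using True \<open>n > 0\<close> by (auto simp: less_mult_imp_div_less)
        from nth_matmul_input(1)[OF carr(3,2) this] in0[OF carr(3,2)] JJ[OF ij] this
        show False by (simp add: J_def)
      next
        case False
        define r' where "r' = r - n * n"
        have r': "r' < n * n" "r = n * n + r'" using r False by (auto simp: r'_def)
        have "r' div n < n" "r' mod n < n" using r' \<open>n > 0\<close> by (auto simp: less_mult_imp_div_less)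
        from nth_matmul_input(2)[OF carr(2,3) this] in0[OF carr(2,3)] JJ[OF ij] this
        show False by (simp add: J_def add.assoc r'(2))
      qed
    qed
    ultimately show ?thesis using Reg by auto
  qed
  define reg where "reg = (\<lambda>(i, j). case out i j of Reg r \<Rightarrow> r | _ \<Rightarrow> 0)"
  have reg: "out i j = Reg (reg (i, j))" "reg (i, j) \<in> {2 * (n * n)..<2 * (n * n) + length p}"
    if "i < n" "j < n" for i j
    using ex[OF that] by (auto simp: reg_def)
  have "inj_on reg I"
  proof (rule inj_onI, rule ccontr)
    fix z z' assume "z \<in> I" "z' \<in> I" and eq: "reg z = reg z'" and "z \<noteq> z'"
    then obtain i j i' j' where z: "z = (i, j)" "z' = (i', j')" "i < n" "j < n" "i' < n" "j' < n"
      by (auto simp: I_def)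
    let ?A = "E (\<lambda>a. a = i) (\<lambda>_. True)" and ?B = "E (\<lambda>_. True) (\<lambda>b. b = j)"
    obtain rs where rs: "\<And>i j. i < n \<Longrightarrow> j < n \<Longrightarrow> operand_value rs (out i j) = Some ((?A * ?B) $$ (i, j))"
      using p carr unfolding computes_matmul_def by meson
    have "out i j = out i' j'" using reg(1) eq z by metis
    then have "(?A * ?B) $$ (i, j) = (?A * ?B) $$ (i', j')" using rs z by (metis option.inject)
    moreover have "(?A * ?B) $$ (i, j) = of_nat n" using z by (auto simp: E_def scalar_prod_def)
    moreover have "(?A * ?B) $$ (i', j') = 0"
      using z \<open>z \<noteq> z'\<close> by (auto simp: E_def scalar_prod_def intro!: sum.neutral)
    ultimately show False using z by auto
  qed
  moreover have "reg ` I \<subseteq> {2 * (n * n)..<2 * (n * n) + length p}" using reg(2) by (auto simp: I_def)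
  ultimately have "card I \<le> card {2 * (n * n)..<2 * (n * n) + length p}" by (intro card_inj_on_le) auto
  then show ?thesis by (simp add: I_def)
qed

lemma matmul_in_O_powr_ge_2:
  assumes "matmul_in_O_powr \<tau>"
  shows "\<tau> \<ge> 2"
proof (rule ccontr)
  assume "\<not> \<tau> \<ge> 2"
  obtain p out where p: "\<And>n. computes_matmul n (p n) (out n)"
    "(\<lambda>n. real (length (p n))) \<in> O(\<lambda>n. real n powr \<tau>)"
    using assms unfolding matmul_in_O_powr_def by blast
  have "(\<lambda>n. real n powr 2) \<in> O(\<lambda>n. real (length (p n)))"
  proof (rule landau_o.big_mono, rule always_eventually, rule allI)
    fix n
    have "real (n * n) \<le> real (length (p n))" using computes_matmul_length_ge[OF p(1)] of_nat_le_iff by blast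
    then show "norm (real n powr 2) \<le> norm (real (length (p n)))" by (simp add: power2_eq_square)
  qed
  with p(2) have "(\<lambda>n. real n powr 2) \<in> O(\<lambda>n. real n powr \<tau>)" by (rule landau_o.big_trans[rotated])
  then have "2 \<le> \<tau>" using powr_bigo_iff[OF filterlim_real_sequentially sequentially_bot, of 2 \<tau>] by blast
  with \<open>\<not> \<tau> \<ge> 2\<close> show False by simp
qed

lemma matmul_exponent_eq_2:
  assumes "\<And>\<tau>. \<tau> > 2 \<Longrightarrow> matmul_in_O_powr \<tau>"
  shows "matmul_exponent = 2"
  unfolding matmul_exponent_def
proof (rule Least_equality)
  show "\<forall>\<epsilon>>0. matmul_in_O_powr (2 + \<epsilon>)" using assms by simp
next
  fix w assume "\<forall>\<epsilon>>0. matmul_in_O_powr (w + \<epsilon>)"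
  then have "2 \<le> w + \<epsilon>" if "\<epsilon> > 0" for \<epsilon> using matmul_in_O_powr_ge_2 that by blast
  then show "2 \<le> w" by (meson field_le_epsilon)
qed

section \<open>Characters of finite abelian groups\<close>

text \<open>The domain \<open>K\<close> is a parameter because characters are built by extension
  from subgroups.\<close>

definition (in group) character_on :: "'a set \<Rightarrow> ('a \<Rightarrow> complex) \<Rightarrow> bool" where
  "character_on K \<chi> \<longleftrightarrow> \<chi> \<one> = 1 \<and> (\<forall>x\<in>K. \<forall>y\<in>K. \<chi> (x \<otimes> y) = \<chi> x * \<chi> y)"

lemma (in group) subgroup_nat_pow_closed: "subgroup K G \<Longrightarrow> x \<in> K \<Longrightarrow> x [^] (n::nat) \<in> K"
  by (induction n) (auto simp: subgroup.one_closed subgroup.m_closed)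

lemma (in group) character_on_pow:
  assumes "subgroup K G" "character_on K \<chi>" "x \<in> K"
  shows "\<chi> (x [^] (n::nat)) = \<chi> x ^ n"
proof (induction n)
  case 0
  then show ?case using assms by (simp add: character_on_def)
next
  case (Suc n)
  then show ?case using assms by (simp add: character_on_def subgroup_nat_pow_closed)
qed

text \<open>With \<open>d\<close> the order of \<open>g\<close> modulo \<open>K\<close>, sending
  \<open>k g^j\<close> to \<open>\<chi>(k) \<zeta>^j\<close> is well defined for every root \<zeta>
  of \<open>\<zeta>^d = \<chi>(g^d)\<close>. The freedom in \<zeta>, together with
  \<open>d \<ge> 2\<close>, is what later separates \<open>g\<close> from the identity.\<close>

lemma (in comm_group) character_on_extend:
  assumes fin: "finite (carrier G)" and K: "subgroup K G" and chi: "character_on K \<chi>"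
    and g: "g \<in> carrier G" "g \<notin> K"
  shows "\<exists>d \<ge> 2. (\<forall>\<zeta>. \<zeta> ^ d = \<chi> (g [^] d) \<longrightarrow> (\<exists>K' \<chi>'. subgroup K' G \<and> K \<subseteq> K' \<and> g \<in> K' \<and> character_on K' \<chi>' \<and>
      (\<forall>x\<in>K. \<chi>' x = \<chi> x) \<and> \<chi>' g = \<zeta>))"
proof -
  have Kc: "x \<in> carrier G" if "x \<in> K" for x using K that by (rule subgroup.mem_carrier)
  define d :: nat where "d = (LEAST d. d > 0 \<and> g [^] d \<in> K)"
  have o: "g [^] order G = \<one>" "order G > 0"
    using g(1) fin by (auto simp: pow_order_eq_1 order_gt_0_iff_finite)
  have d: "d > 0 \<and> g [^] d \<in> K" unfolding d_def
    by (rule LeastI[where k = "order G"]) (use o K in \<open>auto simp: subgroup.one_closed\<close>)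
  have d_least: "\<not> (0 < e \<and> e < d \<and> g [^] e \<in> K)" for e :: nat
    using not_less_Least[of e "\<lambda>d. d > 0 \<and> g [^] d \<in> K"] unfolding d_def by blast
  have d2: "d \<ge> 2"
  proof -
    have "d \<noteq> 1" using d g by auto
    then show ?thesis using d by linarith
  qed
  \<comment> \<open>Division with remainder: the remainder also is an exponent leading into
    \<open>K\<close>, hence 0 by minimality of \<open>d\<close>.\<close>
  have dvd: "d dvd e" if "g [^] e \<in> K" for e :: nat
  proof -
    have "g [^] (d * (e div d)) = (g [^] d) [^] (e div d)" using g by (simp add: nat_pow_pow)
    then have 1: "g [^] (d * (e div d)) \<in> K" using d K by (simp add: subgroup_nat_pow_closed)
    have "g [^] e = g [^] (d * (e div d)) \<otimes> g [^] (e mod d)" using g by (simp add: nat_pow_mult)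
    then have "g [^] (e mod d) = inv (g [^] (d * (e div d))) \<otimes> g [^] e"
      using g by (simp add: m_assoc[symmetric])
    then have "g [^] (e mod d) \<in> K" using 1 that K by (simp add: subgroup.m_closed subgroup.m_inv_closed)
    then have "\<not> e mod d > 0" using d_least[of "e mod d"] d by auto
    then show ?thesis by auto
  qed
  have "\<exists>K' \<chi>'. subgroup K' G \<and> K \<subseteq> K' \<and> g \<in> K' \<and> character_on K' \<chi>' \<and>
      (\<forall>x\<in>K. \<chi>' x = \<chi> x) \<and> \<chi>' g = \<zeta>" if z: "\<zeta> ^ d = \<chi> (g [^] d)" for \<zeta>
  proof -
    have wd: "\<chi> k * \<zeta> ^ j = \<chi> k' * \<zeta> ^ j'"
      if "k \<in> K" "k' \<in> K" "k \<otimes> g [^] j = k' \<otimes> g [^] j'" "j \<le> j'" for k k' and j j' :: nat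
    proof -
      have "g [^] j' = g [^] (j' - j) \<otimes> g [^] j" using that g by (simp add: nat_pow_mult)
      then have "k \<otimes> g [^] j = (k' \<otimes> g [^] (j' - j)) \<otimes> g [^] j"
        using that g Kc by (simp add: m_assoc)
      then have k: "k = k' \<otimes> g [^] (j' - j)"
        using g Kc that by (metis m_closed nat_pow_closed right_cancel)
      then have "g [^] (j' - j) = inv k' \<otimes> k" using g Kc that by (simp add: m_assoc[symmetric])
      then have inK: "g [^] (j' - j) \<in> K" using K that by (simp add: subgroup.m_closed subgroup.m_inv_closed)
      then obtain e where e: "j' - j = d * e" using dvd by blast
      have "\<chi> k = \<chi> k' * \<chi> (g [^] (j' - j))" using k inK chi that unfolding character_on_def by blast
      also have "\<chi> (g [^] (j' - j)) = \<chi> ((g [^] d) [^] e)" using e g by (simp add: nat_pow_pow)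
      also have "\<dots> = \<chi> (g [^] d) ^ e" by (rule character_on_pow[OF K chi]) (use d in auto)
      also have "\<dots> = \<zeta> ^ (j' - j)" using e by (simp add: power_mult z)
      finally have "\<chi> k * \<zeta> ^ j = \<chi> k' * (\<zeta> ^ (j' - j) * \<zeta> ^ j)" by simp
      also have "\<zeta> ^ (j' - j) * \<zeta> ^ j = \<zeta> ^ j'" using that by (simp add: power_add[symmetric])
      finally show ?thesis .
    qed
    define K' where "K' = {k \<otimes> g [^] j | k j. k \<in> K \<and> j \<in> (UNIV :: nat set)}"
    define \<chi>' where "\<chi>' x = (SOME c. \<exists>k j. k \<in> K \<and> x = k \<otimes> g [^] (j :: nat) \<and> c = \<chi> k * \<zeta> ^ j)" for x
    have chi': "\<chi>' (k \<otimes> g [^] j) = \<chi> k * \<zeta> ^ j" if "k \<in> K" for k and j :: nat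
    proof -
      have "\<exists>k1 j1. k1 \<in> K \<and> k \<otimes> g [^] j = k1 \<otimes> g [^] (j1 :: nat) \<and> \<chi>' (k \<otimes> g [^] j) = \<chi> k1 * \<zeta> ^ j1"
        unfolding \<chi>'_def by (rule someI_ex) (use that in auto)
      then obtain k1 and j1 :: nat where *: "k1 \<in> K" "k \<otimes> g [^] j = k1 \<otimes> g [^] j1"
          "\<chi>' (k \<otimes> g [^] j) = \<chi> k1 * \<zeta> ^ j1" by blast
      show ?thesis
        using wd[OF that *(1,2)] wd[OF *(1) that *(2)[symmetric]] *(3) by (cases "j \<le> j1") auto
    qed
    have mult: "(k \<otimes> g [^] i) \<otimes> (k' \<otimes> g [^] j) = (k \<otimes> k') \<otimes> g [^] (i + j)"
      if "k \<in> K" "k' \<in> K" for k k' and i j :: nat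
      using that Kc g by (simp add: nat_pow_mult[symmetric] m_ac)
    have "subgroup K' G"
    proof (rule subgroupI)
      show "K' \<subseteq> carrier G" using g Kc by (auto simp: K'_def)
      show "K' \<noteq> {}" using subgroup.one_closed[OF K] by (auto simp: K'_def)
      fix x assume "x \<in> K'"
      then obtain k and j :: nat where x: "x = k \<otimes> g [^] j" "k \<in> K" by (auto simp: K'_def)
      \<comment> \<open>Exponents are natural numbers, so the inverse of \<open>g^j\<close> is
        written as \<open>g^l\<close> with \<open>j + l\<close> a multiple of the group
        order.\<close>
      define l where "l = j * (order G - 1)"
      have jl: "j + l = order G * j" using o(2) by (simp add: l_def algebra_simps)
      have "g [^] (j + l) = \<one>" using o(1) g unfolding jl by (simp add: nat_pow_pow[symmetric])
      moreover have "x \<otimes> (inv k \<otimes> g [^] l) = (k \<otimes> inv k) \<otimes> g [^] (j + l)"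
        unfolding x(1) by (rule mult) (use x K in \<open>auto simp: subgroup.m_inv_closed\<close>)
      ultimately have "x \<otimes> (inv k \<otimes> g [^] l) = \<one>" using x Kc by simp
      then have "inv x = inv k \<otimes> g [^] l" using x Kc g by (intro inv_unique'[symmetric]) (auto simp: m_comm)
      then show "inv x \<in> K'" using x K by (auto simp: K'_def subgroup.m_inv_closed)
      fix y assume "y \<in> K'"
      then obtain k' and j' :: nat where y: "y = k' \<otimes> g [^] j'" "k' \<in> K" by (auto simp: K'_def)
      show "x \<otimes> y \<in> K'" unfolding x(1) y(1) mult[OF x(2) y(2)]
        using x y K by (auto simp: K'_def subgroup.m_closed)
    qed
    moreover have "K \<subseteq> K'"
    proof
      fix x assume x: "x \<in> K"
      then have "x = x \<otimes> g [^] (0::nat)" using Kc by simp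
      with x show "x \<in> K'" unfolding K'_def by blast
    qed
    moreover have g': "g = \<one> \<otimes> g [^] (1::nat)" using g by simp
    then have "g \<in> K'" using subgroup.one_closed[OF K] unfolding K'_def by blast
    moreover have chi'K: "\<chi>' x = \<chi> x" if "x \<in> K" for x
      using chi'[OF that, of 0] that Kc by simp
    moreover have "\<chi>' g = \<zeta>"
      using chi'[OF subgroup.one_closed[OF K], of 1] chi g by (simp add: character_on_def)
    moreover have "character_on K' \<chi>'"
      unfolding character_on_def
    proof (intro conjI ballI)
      show "\<chi>' \<one> = 1" using chi'K[OF subgroup.one_closed[OF K]] chi by (simp add: character_on_def)
      fix x y assume "x \<in> K'" "y \<in> K'"
      then obtain k k' and j j' :: nat where x: "x = k \<otimes> g [^] j" "k \<in> K" "y = k' \<otimes> g [^] j'" "k' \<in> K"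
        by (auto simp: K'_def)
      show "\<chi>' (x \<otimes> y) = \<chi>' x * \<chi>' y"
        unfolding x(1,3) mult[OF x(2,4)]
        using x K chi by (simp add: chi' subgroup.m_closed power_add character_on_def)
    qed
    ultimately show ?thesis by blast
  qed
  then show ?thesis using d2 by blast
qed

lemma complex_root_exists: 
  assumes "d > 0"
  shows "\<exists>z :: complex. z ^ d = c"
proof (cases "c = 0")
  case True
  then show ?thesis using assms by (intro exI[of _ 0]) auto
next
  case False
  have "cis (Arg c / d) ^ d = cis (Arg c)" using assms by (simp add: DeMoivre)
  moreover have "complex_of_real (root d (cmod c)) ^ d = cmod c" using assms
    by (simp add: of_real_power[symmetric] real_root_pow_pos2)
  ultimately have "(of_real (root d (cmod c)) * cis (Arg c / d)) ^ d = c"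
    using False cis_Arg[OF False] by (simp add: power_mult_distrib sgn_eq)
  then show ?thesis by blast
qed

lemma (in comm_group) character_on_extend_carrier:
  assumes fin: "finite (carrier G)" and "subgroup K G" "character_on K \<chi>"
  shows "\<exists>\<chi>'. character_on (carrier G) \<chi>' \<and> (\<forall>x\<in>K. \<chi>' x = \<chi> x)"
  using assms(2,3)
proof (induction "card (carrier G) - card K" arbitrary: K \<chi> rule: less_induct)
  case less
  have sub: "K \<subseteq> carrier G" using less.prems(1) by (rule subgroup.subset)
  show ?case
  proof (cases "K = carrier G")
    case True
    then show ?thesis using less.prems by blast
  next
    case False
    then obtain g where g: "g \<in> carrier G" "g \<notin> K" using sub by blast
    obtain d where d: "d \<ge> 2" "\<And>\<zeta>. \<zeta> ^ d = \<chi> (g [^] d) \<Longrightarrow>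
       \<exists>K' \<chi>'. subgroup K' G \<and> K \<subseteq> K' \<and> g \<in> K' \<and> character_on K' \<chi>' \<and>
      (\<forall>x\<in>K. \<chi>' x = \<chi> x) \<and> \<chi>' g = \<zeta>"
      using character_on_extend[OF fin less.prems g] by blast
    obtain \<zeta> where "\<zeta> ^ d = \<chi> (g [^] d)" using complex_root_exists[of d] d(1) by fastforce
    then obtain K' \<chi>' where K': "subgroup K' G" "K \<subseteq> K'" "g \<in> K'" "character_on K' \<chi>'"
      "\<forall>x\<in>K. \<chi>' x = \<chi> x" using d(2) by blast
    have sub': "K' \<subseteq> carrier G" using K'(1) by (rule subgroup.subset)
    have "card K < card K'" using K' g fin sub' by (intro psubset_card_mono) (auto intro: finite_subset)
    moreover have "card K' \<le> card (carrier G)" using sub' fin by (rule card_mono[rotated])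
    ultimately obtain \<chi>'' where "character_on (carrier G) \<chi>''" "\<forall>x\<in>K'. \<chi>'' x = \<chi>' x"
      using less.hyps[OF _ K'(1,4)] by force
    then show ?thesis using K' by (metis subsetD)
  qed
qed

text \<open>When the trivial character of the trivial subgroup is extended, the value at
  \<open>g\<close> may be any \<open>d\<close>-th root of unity; since \<open>d \<ge> 2\<close>, one
  of them differs from 1.\<close>

lemma (in comm_group) character_separates:
  assumes fin: "finite (carrier G)" and g: "g \<in> carrier G" "g \<noteq> \<one>"
  shows "\<exists>\<chi>. character_on (carrier G) \<chi> \<and> \<chi> g \<noteq> 1"
proof -
  have triv: "subgroup {\<one>} G" "character_on {\<one>} (\<lambda>_. 1)"
    by (auto simp: triv_subgroup character_on_def)
  obtain d where d: "d \<ge> 2" "\<And>\<zeta>. \<zeta> ^ d = (1 :: complex) \<Longrightarrow>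
       \<exists>K' \<chi>'. subgroup K' G \<and> g \<in> K' \<and> character_on K' \<chi>' \<and> \<chi>' g = \<zeta>"
  proof -
    obtain d where d: "d \<ge> 2" "\<forall>\<zeta>. \<zeta> ^ d = (1 :: complex) \<longrightarrow> (\<exists>K' \<chi>'. subgroup K' G \<and> {\<one>} \<subseteq> K' \<and>
         g \<in> K' \<and> character_on K' \<chi>' \<and> (\<forall>x\<in>{\<one>}. \<chi>' x = 1) \<and> \<chi>' g = \<zeta>)"
      using character_on_extend[OF fin triv g(1)] g(2) by blast
    show ?thesis by (rule that[of d]) (use d in blast)+
  qed
  have "card {z :: complex. z ^ d = 1} = d" using d(1) by (intro card_roots_unity_eq) auto
  then have "\<not> {z :: complex. z ^ d = 1} \<subseteq> {1}" using d(1) card_mono[of "{1 :: complex}" "{z. z ^ d = 1}"] by auto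
  then obtain \<zeta> :: complex where "\<zeta> ^ d = 1" "\<zeta> \<noteq> 1" by blast
  then obtain K' \<chi>' where K': "subgroup K' G" "g \<in> K'" "character_on K' \<chi>'" "\<chi>' g \<noteq> 1"
    using d(2) by blast
  then show ?thesis using character_on_extend_carrier[OF fin K'(1,3)] by metis
qed

text \<open>Extensionality identifies characters that agree on the carrier, so that they can be
  counted.\<close>

definition (in group) characters :: "('a \<Rightarrow> complex) set" where
  "characters = {\<chi> \<in> extensional (carrier G). character_on (carrier G) \<chi>}"

lemma (in comm_group) character_root_of_unity:
  assumes fin: "finite (carrier G)" and "character_on (carrier G) \<chi>" "x \<in> carrier G"
  shows "\<chi> x ^ order G = 1"
  using character_on_pow[OF subgroup_self assms(2,3), of "order G"] assms
  by (simp add: pow_order_eq_1 character_on_def)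

lemma (in comm_group) finite_characters:
  assumes fin: "finite (carrier G)"
  shows "finite characters"
proof (rule finite_subset)
  show "characters \<subseteq> carrier G \<rightarrow>\<^sub>E {z. z ^ order G = 1}"
    using character_root_of_unity[OF fin] by (auto simp: characters_def PiE_def)
  have "order G > 0" using fin by (simp add: order_gt_0_iff_finite)
  then have "finite {z :: complex. z ^ order G = 1}" by (intro finite_roots_unity) auto
  then show "finite (carrier G \<rightarrow>\<^sub>E {z :: complex. z ^ order G = 1})" using fin by (intro finite_PiE) auto
qed

text \<open>Multiplication by a character \<psi> with \<open>\<psi> g \<noteq> 1\<close> permutes
  the characters, so the sum equals \<open>\<psi> g\<close> times itself.\<close>

lemma (in comm_group) sum_characters_eq_0:
  assumes fin: "finite (carrier G)" and g: "g \<in> carrier G" "g \<noteq> \<one>"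
  shows "(\<Sum>\<chi>\<in>characters. \<chi> g) = 0"
proof -
  obtain \<psi> where psi: "character_on (carrier G) \<psi>" "\<psi> g \<noteq> 1"
    using character_separates[OF fin g] by blast
  have nz: "\<psi> x \<noteq> 0" if "x \<in> carrier G" for x
    using character_root_of_unity[OF fin psi(1) that] order_gt_0_iff_finite fin by (auto simp: power_0_left)
  define f where "f \<chi> = restrict (\<lambda>x. \<psi> x * \<chi> x) (carrier G)" for \<chi> :: "'a \<Rightarrow> complex"
  define f' where "f' \<chi> = restrict (\<lambda>x. \<chi> x / \<psi> x) (carrier G)" for \<chi> :: "'a \<Rightarrow> complex"
  have "(\<Sum>\<chi>\<in>characters. \<chi> g) = (\<Sum>\<chi>\<in>characters. f \<chi> g)"
  proof (rule sum.reindex_bij_witness[of _ f f'])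
    fix \<chi> assume chi: "\<chi> \<in> characters"
    show "f (f' \<chi>) = \<chi>" "f' (f \<chi>) = \<chi>"
      using chi nz by (auto simp: f_def f'_def characters_def fun_eq_iff extensional_def)
    show "f' \<chi> \<in> characters" "f \<chi> \<in> characters"
      using chi psi by (auto simp: f_def f'_def characters_def character_on_def)
    show "f (f' \<chi>) g = \<chi> g" using \<open>f (f' \<chi>) = \<chi>\<close> by simp
  qed
  also have "\<dots> = \<psi> g * (\<Sum>\<chi>\<in>characters. \<chi> g)" using g by (simp add: f_def sum_distrib_left)
  finally show ?thesis using psi(2) by simp
qed

lemma (in comm_group) sum_character:
  assumes chi: "\<chi> \<in> characters" "\<chi> \<noteq> restrict (\<lambda>_. 1) (carrier G)"
  shows "(\<Sum>g\<in>carrier G. \<chi> g) = 0"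
proof -
  have chi': "character_on (carrier G) \<chi>" "\<chi> \<in> extensional (carrier G)" using chi by (auto simp: characters_def)
  then obtain h where h: "h \<in> carrier G" "\<chi> h \<noteq> 1"
    using chi(2) by (metis extensionalityI restrict_apply' restrict_extensional)
  have "(\<Sum>g\<in>carrier G. \<chi> g) = (\<Sum>g\<in>carrier G. \<chi> (h \<otimes> g))"
    by (rule sum.reindex_bij_witness[of _ "\<lambda>g. h \<otimes> g" "\<lambda>g. inv h \<otimes> g"])
       (use h in \<open>auto simp: m_assoc[symmetric]\<close>)
  also have "\<dots> = \<chi> h * (\<Sum>g\<in>carrier G. \<chi> g)"
    using h chi'(1) by (simp add: character_on_def sum_distrib_left)
  finally show ?thesis using h by simp
qed

text \<open>Double counting of the values \<open>\<chi> g\<close> over all \<chi> and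
  \<open>g\<close>: only the identity contributes in one order of summation, only the trivial
  character in the other.\<close>

lemma (in comm_group) card_characters:
  assumes fin: "finite (carrier G)"
  shows "card characters = order G"
proof -
  let ?t = "restrict (\<lambda>_. 1 :: complex) (carrier G)"
  have t: "?t \<in> characters" by (auto simp: characters_def character_on_def)
  have one: "\<chi> \<one> = 1" if "\<chi> \<in> characters" for \<chi> using that by (auto simp: characters_def character_on_def)
  have "of_nat (card characters) = (\<Sum>\<chi>\<in>characters. \<chi> \<one>)"
    by (subst sum.cong[OF refl one]) auto
  also have "\<dots> = (\<Sum>g\<in>carrier G. \<Sum>\<chi>\<in>characters. \<chi> g)"
    using fin sum_characters_eq_0[OF fin] by (subst sum.remove[of _ \<one>]) (auto simp: sum.neutral)
  also have "\<dots> = (\<Sum>\<chi>\<in>characters. \<Sum>g\<in>carrier G. \<chi> g)" by (rule sum.swap)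
  also have "\<dots> = (\<Sum>g\<in>carrier G. ?t g)"
    using t finite_characters[OF fin] sum_character
    by (subst sum.remove[of _ ?t]) (auto simp: sum.neutral)
  also have "\<dots> = of_nat (order G)" by (simp add: order_def)
  finally show ?thesis using of_nat_eq_iff by blast
qed

lemma (in comm_group) sum_characters:
  assumes fin: "finite (carrier G)" and g: "g \<in> carrier G"
  shows "(\<Sum>\<chi>\<in>characters. \<chi> g) = (if g = \<one> then of_nat (order G) else 0)"
proof (cases "g = \<one>")
  case True
  then have "(\<Sum>\<chi>\<in>characters. \<chi> g) = (\<Sum>\<chi>\<in>characters. 1)"
    by (intro sum.cong) (auto simp: characters_def character_on_def)
  then show ?thesis using True card_characters[OF fin] by simp
qed (use sum_characters_eq_0[OF fin g] in simp)

section \<open>The simultaneous triple product property\<close>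

definition tri :: "('a, 'b) monoid_scheme \<Rightarrow> 'a \<Rightarrow> 'a \<Rightarrow> 'a \<Rightarrow> 'a \<Rightarrow> 'a \<Rightarrow> 'a \<Rightarrow> 'a" where
  "tri G a a' b b' c c' =
     a \<otimes>\<^bsub>G\<^esub> inv\<^bsub>G\<^esub> a' \<otimes>\<^bsub>G\<^esub> (b \<otimes>\<^bsub>G\<^esub> inv\<^bsub>G\<^esub> b') \<otimes>\<^bsub>G\<^esub> (c \<otimes>\<^bsub>G\<^esub> inv\<^bsub>G\<^esub> c')"

text \<open>
  The simultaneous triple product property; the case \<open>i = j = k\<close> is the triple product property of
  each single triple.
\<close>

definition stpp ::
    "('a, 'b) monoid_scheme \<Rightarrow> 'i set \<Rightarrow> ('i \<Rightarrow> 'a set) \<Rightarrow> ('i \<Rightarrow> 'a set) \<Rightarrow> ('i \<Rightarrow> 'a set) \<Rightarrow> bool" where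
  "stpp G I A B C \<longleftrightarrow>
     (\<forall>i\<in>I. A i \<subseteq> carrier G \<and> B i \<subseteq> carrier G \<and> C i \<subseteq> carrier G) \<and>
     (\<forall>i\<in>I. \<forall>j\<in>I. \<forall>k\<in>I. \<forall>a\<in>A i. \<forall>a'\<in>A j. \<forall>b\<in>B j. \<forall>b'\<in>B k. \<forall>c\<in>C k. \<forall>c'\<in>C i.
        tri G a a' b b' c c' = \<one>\<^bsub>G\<^esub> \<longrightarrow> i = j \<and> j = k \<and> a = a' \<and> b = b' \<and> c = c')"

lemma (in comm_group) tri_rotate:
  assumes "a \<in> carrier G" "a' \<in> carrier G" "b \<in> carrier G" "b' \<in> carrier G" "c \<in> carrier G" "c' \<in> carrier G"
  shows "tri G b b' c c' a a' = tri G a a' b b' c c'"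
  using assms by (simp add: tri_def m_ac)

text \<open>The product of the three quotients does not change under rotation in an abelian group,
  and the index pattern \<open>i, j, k\<close> is cyclic.\<close>

lemma (in comm_group) stpp_rotate:
  assumes "stpp G I A B C"
  shows "stpp G I B C A"
proof -
  have sub: "a \<in> carrier G" if "a \<in> A i \<or> a \<in> B i \<or> a \<in> C i" "i \<in> I" for a i
    using that assms unfolding stpp_def by blast
  have *: "i = j \<and> j = k \<and> a = a' \<and> b = b' \<and> c = c'"
    if "i \<in> I" "j \<in> I" "k \<in> I" "a \<in> A i" "a' \<in> A j" "b \<in> B j" "b' \<in> B k" "c \<in> C k" "c' \<in> C i"
      "tri G a a' b b' c c' = \<one>" for i j k a a' b b' c c'
    using that assms unfolding stpp_def by blast
  show ?thesis unfolding stpp_def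
  proof (intro conjI ballI impI)
    fix i j k b b' c c' a a'
    assume ijk: "i \<in> I" "j \<in> I" "k \<in> I"
      and mem: "b \<in> B i" "b' \<in> B j" "c \<in> C j" "c' \<in> C k" "a \<in> A k" "a' \<in> A i"
      and tri: "tri G b b' c c' a a' = \<one>"
    have "a \<in> carrier G" "a' \<in> carrier G" "b \<in> carrier G" "b' \<in> carrier G" "c \<in> carrier G" "c' \<in> carrier G"
      using sub ijk mem by blast+
    then have "tri G a a' b b' c c' = \<one>" using tri tri_rotate[of a a' b b' c c'] by simp
    then have "k = i \<and> i = j \<and> a = a' \<and> b = b' \<and> c = c'" using *[OF ijk(3,1,2)] mem by blast
    then show "i = j" "j = k" "b = b'" "c = c'" "a = a'" by auto
  qed (use sub in auto)
qed

text \<open>The first matrix is placed on the elements \<open>a c^-1\<close>, the second on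
  \<open>c b^-1\<close>, and the result is read off at \<open>a b^-1\<close>, with one rank-one term
  per character. Averaging the characters at the product of the two elements with
  \<open>b a^-1\<close> tests whether that product is the identity; by the simultaneous triple
  product property this singles out the terms of the matrix product.\<close>

lemma (in comm_group) bilinear_mm_of_stpp:
  assumes fin: "finite (carrier G)" and "finite I" and stpp: "stpp G I A B C"
    and card: "\<And>i. i \<in> I \<Longrightarrow> card (A i) = q" "\<And>i. i \<in> I \<Longrightarrow> card (B i) = q" "\<And>i. i \<in> I \<Longrightarrow> card (C i) = q"
  shows "bilinear_mm (card I) q (order G)"
proof -
  let ?Z = "{..<card I} \<times> {..<q} \<times> {..<q}"
  have sub: "A i \<subseteq> carrier G" "B i \<subseteq> carrier G" "C i \<subseteq> carrier G" if "i \<in> I" for i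
    using stpp that unfolding stpp_def by auto
  obtain e where e: "bij_betw e {..<card I} I"
    using \<open>finite I\<close> by (metis ex_bij_betw_nat_finite lessThan_atLeast0)
  have eI: "e t \<in> I" if "t < card I" for t using e that by (auto simp: bij_betw_def)
  have "\<exists>f. bij_betw f {..<q} (X (e t))"
    if "t < card I" "\<And>i. i \<in> I \<Longrightarrow> card (X i) = q" "\<And>i. i \<in> I \<Longrightarrow> X i \<subseteq> carrier G" for X and t
    using that eI[OF that(1)] fin
    by (metis ex_bij_betw_nat_finite lessThan_atLeast0 finite_subset)
  then have ex: "\<exists>f. \<forall>t<card I. bij_betw (f t) {..<q} (X (e t))"
    if "\<And>i. i \<in> I \<Longrightarrow> card (X i) = q" "\<And>i. i \<in> I \<Longrightarrow> X i \<subseteq> carrier G" for X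
    using that by (intro exI[of _ "\<lambda>t. SOME f. bij_betw f {..<q} (X (e t))"]) (metis someI_ex)
  obtain ea where ea: "\<And>t. t < card I \<Longrightarrow> bij_betw (ea t) {..<q} (A (e t))"
    using ex[of A] card(1) sub(1) by blast
  obtain eb where eb: "\<And>t. t < card I \<Longrightarrow> bij_betw (eb t) {..<q} (B (e t))"
    using ex[of B] card(2) sub(2) by blast
  obtain ec where ec: "\<And>t. t < card I \<Longrightarrow> bij_betw (ec t) {..<q} (C (e t))"
    using ex[of C] card(3) sub(3) by blast
  have mem: "ea t i \<in> A (e t)" "eb t i \<in> B (e t)" "ec t i \<in> C (e t)" if "t < card I" "i < q" for t i
    using bij_betwE[OF ea[OF that(1)]] bij_betwE[OF eb[OF that(1)]] bij_betwE[OF ec[OF that(1)]] that(2) by auto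
  have inj: "ea t i = ea t j \<longleftrightarrow> i = j" "eb t i = eb t j \<longleftrightarrow> i = j" "ec t i = ec t j \<longleftrightarrow> i = j"
    "e t = e t' \<longleftrightarrow> t = t'"
    if "t < card I" "t' < card I" "i < q" "j < q" for t t' i j
    using ea eb ec e that by (auto simp: bij_betw_def inj_on_def)
  have memG: "ea t i \<in> carrier G" "eb t i \<in> carrier G" "ec t i \<in> carrier G" if "t < card I" "i < q" for t i
    using mem[OF that] sub[OF eI[OF that(1)]] by auto
  have uq: "i = j \<and> j = k \<and> a = a' \<and> b = b' \<and> c = c'"
    if "i \<in> I" "j \<in> I" "k \<in> I" "a \<in> A i" "a' \<in> A j" "b \<in> B j" "b' \<in> B k" "c \<in> C k" "c' \<in> C i"
      "tri G a a' b b' c c' = \<one>" for i j k a a' b b' c c'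
    using that stpp unfolding stpp_def by blast
  obtain X where X: "bij_betw X {..<order G} characters"
    using finite_characters[OF fin] card_characters[OF fin] by (metis ex_bij_betw_nat_finite lessThan_atLeast0)
  have "order G > 0" using fin by (simp add: order_gt_0_iff_finite)
  define \<alpha> where "\<alpha> r = (\<lambda>(t, i, k). X r (ea t i \<otimes> inv (ec t k)))" for r
  define \<beta> where "\<beta> r = (\<lambda>(t, k, j). X r (ec t k \<otimes> inv (eb t j)))" for r
  define \<gamma> where "\<gamma> r = (\<lambda>(t, i, j). X r (eb t j \<otimes> inv (ea t i)) / of_nat (order G))" for r
  have key: "(\<Sum>r<order G. \<gamma> r (t, i, j) * (\<alpha> r (t1, i1, k1) * \<beta> r (t2, k2, j2))) =
      (if t1 = t \<and> t2 = t \<and> i1 = i \<and> j2 = j \<and> k1 = k2 then 1 else 0)"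
    if "t < card I" "t1 < card I" "t2 < card I" "i < q" "i1 < q" "j < q" "j2 < q" "k1 < q" "k2 < q"
    for t t1 t2 i i1 j j2 k1 k2
  proof -
    let ?g = "tri G (ea t1 i1) (ea t i) (eb t j) (eb t2 j2) (ec t2 k2) (ec t1 k1)"
    have g: "?g \<in> carrier G" using that memG by (auto simp: tri_def)
    have "\<gamma> r (t, i, j) * (\<alpha> r (t1, i1, k1) * \<beta> r (t2, k2, j2)) = X r ?g / of_nat (order G)"
      if r: "r < order G" for r
    proof -
      have chi: "X r (x \<otimes> y) = X r x * X r y" if "x \<in> carrier G" "y \<in> carrier G" for x y
        using X r that by (auto simp: bij_betw_def characters_def character_on_def)
      have "?g = (eb t j \<otimes> inv (ea t i)) \<otimes> ((ea t1 i1 \<otimes> inv (ec t1 k1)) \<otimes> (ec t2 k2 \<otimes> inv (eb t2 j2)))"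
        using \<open>t < _\<close> \<open>t1 < _\<close> \<open>t2 < _\<close> \<open>i < q\<close> \<open>i1 < q\<close> \<open>j < q\<close> \<open>j2 < q\<close> \<open>k1 < q\<close> \<open>k2 < q\<close> memG
        by (simp add: tri_def m_ac)
      then show ?thesis
        using \<open>t < _\<close> \<open>t1 < _\<close> \<open>t2 < _\<close> \<open>i < q\<close> \<open>i1 < q\<close> \<open>j < q\<close> \<open>j2 < q\<close> \<open>k1 < q\<close> \<open>k2 < q\<close> memG
        by (simp add: \<alpha>_def \<beta>_def \<gamma>_def chi)
    qed
    then have "(\<Sum>r<order G. \<gamma> r (t, i, j) * (\<alpha> r (t1, i1, k1) * \<beta> r (t2, k2, j2))) =
        (\<Sum>r<order G. X r ?g) / of_nat (order G)"
      by (simp add: sum_divide_distrib)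
    also have "(\<Sum>r<order G. X r ?g) = (\<Sum>\<chi>\<in>characters. \<chi> ?g)"
      by (rule sum.reindex_bij_betw[OF X])
    also have "\<dots> = (if ?g = \<one> then of_nat (order G) else 0)" by (rule sum_characters[OF fin g])
    also have "?g = \<one> \<longleftrightarrow> t1 = t \<and> t2 = t \<and> i1 = i \<and> j2 = j \<and> k1 = k2"
    proof
      assume "?g = \<one>"
      then have *: "e t1 = e t \<and> e t = e t2 \<and> ea t1 i1 = ea t i \<and> eb t j = eb t2 j2 \<and> ec t2 k2 = ec t1 k1"
        using uq[OF eI[OF that(2)] eI[OF that(1)] eI[OF that(3)] mem(1)[OF that(2,5)] mem(1)[OF that(1,4)]
            mem(2)[OF that(1,6)] mem(2)[OF that(3,7)] mem(3)[OF that(3,9)] mem(3)[OF that(2,8)]] by simp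
      then have t: "t1 = t" "t2 = t"
        using inj(4)[OF that(2,1,4,4)] inj(4)[OF that(1,3,4,4)] by auto
      with * show "t1 = t \<and> t2 = t \<and> i1 = i \<and> j2 = j \<and> k1 = k2"
        using inj(1)[OF that(1,1,5,4)] inj(2)[OF that(1,1,6,7)] inj(3)[OF that(1,1,9,8)] by simp
    qed (use memG that in \<open>auto simp: tri_def\<close>)
    finally show ?thesis using \<open>order G > 0\<close> by auto
  qed
  have "(\<Sum>r<order G. \<gamma> r (t, i, j) * ((\<Sum>z\<in>?Z. \<alpha> r z * u z) * (\<Sum>z\<in>?Z. \<beta> r z * v z))) =
      (\<Sum>k<q. u (t, i, k) * v (t, k, j))" if tij: "t < card I" "i < q" "j < q" for u v t i j
  proof -
    \<comment> \<open>\<open>P\<close> is the support, for the fixed output entry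
      \<open>(t, i, j)\<close>, of the direct sum of the matrix multiplication tensors.\<close>
    define P where "P z z' \<longleftrightarrow> fst z = t \<and> fst z' = t \<and> fst (snd z) = i \<and> snd (snd z') = j \<and>
        snd (snd z) = fst (snd z')" for z z' :: "nat \<times> nat \<times> nat"
    have key': "(\<Sum>r<order G. \<gamma> r (t, i, j) * (\<alpha> r z * \<beta> r z')) = of_bool (P z z')"
      if "z \<in> ?Z" "z' \<in> ?Z" for z z'
      using that key[OF tij(1) _ _ tij(2) _ tij(3)] by (auto simp: P_def)
    have "(\<Sum>r<order G. \<gamma> r (t, i, j) * ((\<Sum>z\<in>?Z. \<alpha> r z * u z) * (\<Sum>z\<in>?Z. \<beta> r z * v z))) =
        (\<Sum>r<order G. \<Sum>z\<in>?Z. \<Sum>z'\<in>?Z. \<gamma> r (t, i, j) * (\<alpha> r z * \<beta> r z') * (u z * v z'))"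
      unfolding sum_product by (simp add: sum_distrib_left mult_ac)
    also have "\<dots> = (\<Sum>z\<in>?Z. \<Sum>r<order G. \<Sum>z'\<in>?Z. \<gamma> r (t, i, j) * (\<alpha> r z * \<beta> r z') * (u z * v z'))"
      by (rule sum.swap)
    also have "\<dots> = (\<Sum>z\<in>?Z. \<Sum>z'\<in>?Z. \<Sum>r<order G. \<gamma> r (t, i, j) * (\<alpha> r z * \<beta> r z') * (u z * v z'))"
      by (rule sum.cong[OF refl], rule sum.swap)
    also have "\<dots> = (\<Sum>z\<in>?Z. \<Sum>z'\<in>?Z. of_bool (P z z') * (u z * v z'))"
    proof (rule sum.cong[OF refl], rule sum.cong[OF refl])
      fix z z' assume "z \<in> ?Z" "z' \<in> ?Z"
      then show "(\<Sum>r<order G. \<gamma> r (t, i, j) * (\<alpha> r z * \<beta> r z') * (u z * v z')) = of_bool (P z z') * (u z * v z')"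
        using key' by (simp only: sum_distrib_right[symmetric])
    qed
    also have "\<dots> = (\<Sum>p\<in>?Z \<times> ?Z. of_bool (P (fst p) (snd p)) * (u (fst p) * v (snd p)))"
      by (simp only: sum.cartesian_product case_prod_unfold)
    also have "\<dots> = (\<Sum>p\<in>(\<lambda>k. ((t, i, k), (t, k, j))) ` {..<q}. of_bool (P (fst p) (snd p)) * (u (fst p) * v (snd p)))"
    proof (rule sum.mono_neutral_right)
      show "\<forall>p\<in>?Z \<times> ?Z - (\<lambda>k. ((t, i, k), (t, k, j))) ` {..<q}.
          of_bool (P (fst p) (snd p)) * (u (fst p) * v (snd p)) = 0"
        by (auto simp: P_def image_iff)
    qed (use tij in auto)
    also have "\<dots> = (\<Sum>k<q. u (t, i, k) * v (t, k, j))"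
      by (subst sum.reindex) (auto simp: inj_on_def P_def)
    finally show ?thesis .
  qed
  then show ?thesis unfolding bilinear_mm_def by blast
qed

section \<open>Families in powers of a group, and symmetrization\<close>

lemma (in comm_group) comm_group_power: "comm_group (product_group W (\<lambda>_. G))"
proof (rule group.group_comm_groupI)
  show "group (product_group W (\<lambda>_. G))" by simp
  fix x y assume "x \<in> carrier (product_group W (\<lambda>_. G))" "y \<in> carrier (product_group W (\<lambda>_. G))"
  then show "x \<otimes>\<^bsub>product_group W (\<lambda>_. G)\<^esub> y = y \<otimes>\<^bsub>product_group W (\<lambda>_. G)\<^esub> x"
    by (auto intro!: restrict_ext m_comm)
qed

lemma order_power_group: "finite W \<Longrightarrow> order (product_group W (\<lambda>_. G)) = order G ^ card W"
  by (simp add: order_def card_PiE)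

lemma (in comm_group) tri_power:
  assumes "a \<in> W \<rightarrow>\<^sub>E carrier G" "a' \<in> W \<rightarrow>\<^sub>E carrier G" "b \<in> W \<rightarrow>\<^sub>E carrier G"
    "b' \<in> W \<rightarrow>\<^sub>E carrier G" "c \<in> W \<rightarrow>\<^sub>E carrier G" "c' \<in> W \<rightarrow>\<^sub>E carrier G" and w: "w \<in> W"
  shows "tri (product_group W (\<lambda>_. G)) a a' b b' c c' w = tri G (a w) (a' w) (b w) (b' w) (c w) (c' w)"
  using w by (simp add: tri_def inv_product_group[OF assms(2)] inv_product_group[OF assms(4)]
      inv_product_group[OF assms(6)])

text \<open>The two halves of the property are checked at different scales: equality of the elements
  in each coordinate \<open>w\<close> separately, equality of the indices from all coordinates at
  once. This lets a global combinatorial argument stand in for uniqueness within one copy of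
  \<open>G\<close>.\<close>

lemma (in comm_group) stpp_power:
  assumes sub: "\<And>w i. w \<in> W \<Longrightarrow> i \<in> I \<Longrightarrow> A w i \<subseteq> carrier G \<and> B w i \<subseteq> carrier G \<and> C w i \<subseteq> carrier G"
    and uniq: "\<And>i j k. i \<in> I \<Longrightarrow> j \<in> I \<Longrightarrow> k \<in> I \<Longrightarrow>
      (\<And>w. w \<in> W \<Longrightarrow> \<exists>a\<in>A w i. \<exists>a'\<in>A w j. \<exists>b\<in>B w j. \<exists>b'\<in>B w k. \<exists>c\<in>C w k. \<exists>c'\<in>C w i.
         tri G a a' b b' c c' = \<one>) \<Longrightarrow> i = j \<and> j = k"
    and tpp: "\<And>i w a a' b b' c c'. i \<in> I \<Longrightarrow> w \<in> W \<Longrightarrow> a \<in> A w i \<Longrightarrow> a' \<in> A w i \<Longrightarrow>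
      b \<in> B w i \<Longrightarrow> b' \<in> B w i \<Longrightarrow> c \<in> C w i \<Longrightarrow> c' \<in> C w i \<Longrightarrow> tri G a a' b b' c c' = \<one> \<Longrightarrow>
      a = a' \<and> b = b' \<and> c = c'"
  shows "stpp (product_group W (\<lambda>_. G)) I (\<lambda>i. \<Pi>\<^sub>E w\<in>W. A w i) (\<lambda>i. \<Pi>\<^sub>E w\<in>W. B w i) (\<lambda>i. \<Pi>\<^sub>E w\<in>W. C w i)"
  unfolding stpp_def
proof (intro conjI ballI impI)
  fix i assume "i \<in> I"
  then show "(\<Pi>\<^sub>E w\<in>W. A w i) \<subseteq> carrier (product_group W (\<lambda>_. G))"
    "(\<Pi>\<^sub>E w\<in>W. B w i) \<subseteq> carrier (product_group W (\<lambda>_. G))"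
    "(\<Pi>\<^sub>E w\<in>W. C w i) \<subseteq> carrier (product_group W (\<lambda>_. G))"
    using sub by (simp_all add: PiE_mono)
next
  fix i j k a a' b b' c c'
  assume I: "i \<in> I" "j \<in> I" "k \<in> I"
    and mem: "a \<in> (\<Pi>\<^sub>E w\<in>W. A w i)" "a' \<in> (\<Pi>\<^sub>E w\<in>W. A w j)" "b \<in> (\<Pi>\<^sub>E w\<in>W. B w j)"
      "b' \<in> (\<Pi>\<^sub>E w\<in>W. B w k)" "c \<in> (\<Pi>\<^sub>E w\<in>W. C w k)" "c' \<in> (\<Pi>\<^sub>E w\<in>W. C w i)"
    and eq: "tri (product_group W (\<lambda>_. G)) a a' b b' c c' = \<one>\<^bsub>product_group W (\<lambda>_. G)\<^esub>"
  have le: "(\<Pi>\<^sub>E w\<in>W. A w l) \<subseteq> W \<rightarrow>\<^sub>E carrier G" "(\<Pi>\<^sub>E w\<in>W. B w l) \<subseteq> W \<rightarrow>\<^sub>E carrier G"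
    "(\<Pi>\<^sub>E w\<in>W. C w l) \<subseteq> W \<rightarrow>\<^sub>E carrier G" if "l \<in> I" for l
    using sub that by (simp_all add: PiE_mono)
  have car: "a \<in> W \<rightarrow>\<^sub>E carrier G" "a' \<in> W \<rightarrow>\<^sub>E carrier G" "b \<in> W \<rightarrow>\<^sub>E carrier G"
    "b' \<in> W \<rightarrow>\<^sub>E carrier G" "c \<in> W \<rightarrow>\<^sub>E carrier G" "c' \<in> W \<rightarrow>\<^sub>E carrier G"
    using mem le I by (meson subsetD)+
  have one: "tri G (a w) (a' w) (b w) (b' w) (c w) (c' w) = \<one>" if "w \<in> W" for w
    using tri_power[OF car that] eq that by simp
  have at: "a w \<in> A w i" "a' w \<in> A w j" "b w \<in> B w j" "b' w \<in> B w k" "c w \<in> C w k" "c' w \<in> C w i"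
    if "w \<in> W" for w using mem that by (auto simp: PiE_iff)
  have ij: "i = j \<and> j = k" by (rule uniq[OF I]) (use one at in blast)
  then show "i = j" "j = k" by auto
  have "a w = a' w \<and> b w = b' w \<and> c w = c' w" if "w \<in> W" for w
    using tpp[OF I(1) that _ _ _ _ _ _ one[OF that]] at[OF that] ij by auto
  then show "a = a'" "b = b'" "c = c'"
    using car by (auto intro!: PiE_ext[where k = W])
qed

text \<open>In the third power, the family is multiplied with its two rotations. Each new set has
  one factor of each of the sizes \<open>a\<close>, \<open>b\<close>, \<open>c\<close>, which makes
  the formats square; the indices vary independently over the coordinates, whence
  \<open>card I ^ 3\<close>.\<close>

lemma (in comm_group) stpp_symmetrize:
  fixes I :: "'i set"
  assumes fin: "finite (carrier G)" and "finite I" and stpp: "stpp G I A B C"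
    and card: "\<And>i. i \<in> I \<Longrightarrow> card (A i) = a" "\<And>i. i \<in> I \<Longrightarrow> card (B i) = b" "\<And>i. i \<in> I \<Longrightarrow> card (C i) = c"
  shows "bilinear_mm (card I ^ 3) (a * b * c) (order G ^ 3)"
proof -
  define W :: "nat set" where "W = {0, 1, 2}"
  define X where "X w = (if w = 0 then A else if w = 1 then B else C)" for w :: nat
  define Y where "Y w = (if w = 0 then B else if w = 1 then C else A)" for w :: nat
  define Z where "Z w = (if w = 0 then C else if w = 1 then A else B)" for w :: nat
  let ?P = "product_group W (\<lambda>_. G)" and ?J = "W \<rightarrow>\<^sub>E I"
  have W: "finite W" "card W = 3" by (auto simp: W_def)
  have rot: "stpp G I (X w) (Y w) (Z w)" if "w \<in> W" for w
    using that stpp stpp_rotate[OF stpp] stpp_rotate[OF stpp_rotate[OF stpp]]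
    by (auto simp: W_def X_def Y_def Z_def)
  have "stpp ?P ?J (\<lambda>f. \<Pi>\<^sub>E w\<in>W. X w (f w)) (\<lambda>f. \<Pi>\<^sub>E w\<in>W. Y w (f w)) (\<lambda>f. \<Pi>\<^sub>E w\<in>W. Z w (f w))"
  proof (rule stpp_power)
    fix w f assume wf: "w \<in> W" "f \<in> ?J"
    then have "f w \<in> I" by auto
    then show "X w (f w) \<subseteq> carrier G \<and> Y w (f w) \<subseteq> carrier G \<and> Z w (f w) \<subseteq> carrier G"
      using rot[OF wf(1)] unfolding stpp_def by blast
  next
    fix f g h assume fgh: "f \<in> ?J" "g \<in> ?J" "h \<in> ?J"
      and ex: "\<And>w. w \<in> W \<Longrightarrow> \<exists>a\<in>X w (f w). \<exists>a'\<in>X w (g w). \<exists>b\<in>Y w (g w). \<exists>b'\<in>Y w (h w).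
        \<exists>c\<in>Z w (h w). \<exists>c'\<in>Z w (f w). tri G a a' b b' c c' = \<one>"
    have "f w = g w \<and> g w = h w" if "w \<in> W" for w
    proof -
      have "f w \<in> I" "g w \<in> I" "h w \<in> I" using fgh that by auto
      then show ?thesis using ex[OF that] rot[OF that] unfolding stpp_def by blast
    qed
    then show "f = g \<and> g = h" using fgh by (auto intro!: PiE_ext[where k = W])
  next
    fix f w a a' b b' c c'
    assume "f \<in> ?J" and w: "w \<in> W"
      and *: "a \<in> X w (f w)" "a' \<in> X w (f w)" "b \<in> Y w (f w)" "b' \<in> Y w (f w)" "c \<in> Z w (f w)" "c' \<in> Z w (f w)"
      "tri G a a' b b' c c' = \<one>"
    then have "f w \<in> I" by auto
    then show "a = a' \<and> b = b' \<and> c = c'" using * rot[OF w] unfolding stpp_def by blast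
  qed
  moreover have "card (\<Pi>\<^sub>E w\<in>W. X w (f w)) = a * b * c" "card (\<Pi>\<^sub>E w\<in>W. Y w (f w)) = a * b * c"
    "card (\<Pi>\<^sub>E w\<in>W. Z w (f w)) = a * b * c" if "f \<in> ?J" for f
  proof -
    have "f 0 \<in> I" "f 1 \<in> I" "f 2 \<in> I" using that by (auto simp: W_def)
    then show "card (\<Pi>\<^sub>E w\<in>W. X w (f w)) = a * b * c" "card (\<Pi>\<^sub>E w\<in>W. Y w (f w)) = a * b * c"
      "card (\<Pi>\<^sub>E w\<in>W. Z w (f w)) = a * b * c"
      by (simp_all add: card_PiE W_def X_def Y_def Z_def card)
  qed
  moreover have "finite ?J" "finite (carrier ?P)" using fin \<open>finite I\<close> W by (auto intro!: finite_PiE)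
  ultimately have "bilinear_mm (card ?J) (a * b * c) (order ?P)"
    by (intro comm_group.bilinear_mm_of_stpp[OF comm_group_power])
  then show ?thesis using W by (simp add: order_power_group card_PiE)
qed

text \<open>Cubing \<open>bound\<close> gives rank at most \<open>N * q powr \<sigma>\<close> for
  \<open>N\<close> products of size \<open>q\<close>. The factor 2 in \<open>large\<close> pays for
  rounding \<open>q powr \<tau>\<close> down to the integer \<open>K\<close>.\<close>

lemma (in comm_group) matmul_in_O_powr_of_stpp:
  fixes \<sigma> \<tau> :: real
  assumes fin: "finite (carrier G)" and I: "finite I" "I \<noteq> {}" and stpp: "stpp G I A B C"
    and card: "\<And>i. i \<in> I \<Longrightarrow> card (A i) = a" "\<And>i. i \<in> I \<Longrightarrow> card (B i) = b" "\<And>i. i \<in> I \<Longrightarrow> card (C i) = c"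
    and bound: "real (order G) \<le> card I * real (a * b * c) powr (\<sigma> / 3)"
    and \<sigma>: "2 \<le> \<sigma>" "\<sigma> < \<tau>" and large: "real (a * b * c) powr (\<tau> - \<sigma>) \<ge> 2"
  shows "matmul_in_O_powr \<tau>"
proof -
  define q where "q = a * b * c"
  define N where "N = card I ^ 3"
  define K where "K = nat \<lfloor>real q powr \<tau>\<rfloor>"
  have "N > 0" using I by (simp add: N_def card_gt_0_iff)
  have large': "real q powr (\<tau> - \<sigma>) \<ge> 2" using large by (simp add: q_def)
  \<comment> \<open>Powers of 0 and of 1 stay below 2.\<close>
  then have "q \<noteq> 0" "q \<noteq> 1" by (intro notI; simp)+
  then have q: "q \<ge> 2" by simp
  have "real q powr \<sigma> * 2 \<le> real q powr \<sigma> * real q powr (\<tau> - \<sigma>)"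
    using large by (intro mult_left_mono) (auto simp: q_def)
  also have "\<dots> = real q powr \<tau>" by (simp flip: powr_add)
  finally have 1: "real q powr \<sigma> * 2 \<le> real q powr \<tau>" .
  have 2: "real q ^ 2 \<le> real q powr \<sigma>" using q \<sigma> powr_mono[of 2 \<sigma> "real q"] by (simp add: powr_numeral)
  have "1 \<le> real q ^ 2" using q by simp
  then have 3: "real q powr \<sigma> < real K"
    using 1 2 unfolding K_def by linarith
  have "real (order G ^ 3) \<le> (card I * real q powr (\<sigma> / 3)) ^ 3"
    using bound by (simp add: q_def power_mono del: of_nat_mult)
  also have "\<dots> = real N * real q powr \<sigma>"
    using q by (simp add: N_def power_mult_distrib powr_powr flip: powr_realpow)
  also have "\<dots> \<le> real N * real K" using 3 by (intro mult_left_mono) auto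
  finally have R: "order G ^ 3 \<le> K * N" by (simp flip: of_nat_mult add: mult.commute)
  have "bilinear_mm N q (K * N)"
    using bilinear_mm_mono[OF stpp_symmetrize[OF fin I(1) stpp card] R] by (simp add: N_def q_def)
  moreover have "real (q\<^sup>2) < real K" using 2 3 unfolding of_nat_power by (rule le_less_trans)
  then have "K > q\<^sup>2" by (rule of_nat_less_imp_less)
  moreover have "real K \<le> real q powr \<tau>" by (simp add: K_def)
  ultimately show ?thesis using \<open>N > 0\<close> q \<sigma> by (intro matmul_in_O_powr_of_bilinear_mm[of N q K]) auto
qed

text \<open>The quotient \<open>n^n / n!\<close> is a single term of the exponential series for
  \<open>e^n\<close>.\<close>

lemma fact_ge_power: "(real n / exp 1) ^ n \<le> fact n"
proof -
  have s: "(\<lambda>i. real n ^ i / fact i) sums exp (real n)"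
    using exp_converges[of "real n"] by (simp add: divide_inverse scaleR_conv_of_real mult.commute)
  have "real n ^ n / fact n \<le> exp (real n)"
    using sum_le_suminf[OF sums_summable[OF s], of "{n}"] sums_unique[OF s] by simp
  also have "exp (real n) = exp 1 ^ n" by (simp add: exp_of_nat_mult[symmetric])
  finally show ?thesis by (simp add: power_divide field_simps)
qed

text \<open>This reduces the inequality for \<open>M!\<close> triples in a power group to a single
  block: \<open>g\<close> is the group order per permuted point, and \<open>t ^ M\<close> a lower
  bound for the product \<open>V\<close> of the three sizes.\<close>

lemma permutation_power_bound:
  fixes \<sigma> g t :: real
  assumes "0 \<le> g" "0 \<le> t" "0 \<le> \<sigma>" and le: "g \<le> real M / exp 1 * t powr (\<sigma> / 3)" and "t ^ M \<le> V"
  shows "g ^ M \<le> fact M * V powr (\<sigma> / 3)"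
proof -
  have "g ^ M \<le> (real M / exp 1 * t powr (\<sigma> / 3)) ^ M" using assms by (intro power_mono)
  also have "\<dots> = (real M / exp 1) ^ M * (t powr (\<sigma> / 3)) ^ M" by (rule power_mult_distrib)
  also have "(t powr (\<sigma> / 3)) ^ M = (t ^ M) powr (\<sigma> / 3)"
  proof (cases "t = 0")
    case True
    then show ?thesis by (cases M) auto
  next
    case False
    then show ?thesis using \<open>0 \<le> t\<close> by (simp add: powr_powr mult.commute flip: powr_realpow)
  qed
  also have "(real M / exp 1) ^ M * (t ^ M) powr (\<sigma> / 3) \<le> fact M * V powr (\<sigma> / 3)"
    using assms fact_ge_power by (intro mult_mono powr_mono2) auto
  finally show ?thesis .
qed

section \<open>Strong uniquely solvable puzzles\<close>

lemma tri_mod_3: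
  assumes "{a, a', b, b', c, c'} \<subseteq> {0, 1, 2}"
  shows "tri (integer_mod_group 3) a a' b b' c c' = (a - a' + (b - b') + (c - c')) mod 3"
proof -
  have "x \<in> carrier (integer_mod_group 3)" if "x \<in> {0, 1, 2}" for x
    using that by (auto simp: carrier_integer_mod_group)
  then show ?thesis using assms by (simp add: tri_def mod_simps)
qed

text \<open>
  Over every position of the puzzle, the three subsets of \<open>\<int>/3\<close> are \<open>{0}\<close>, \<open>{0}\<close> and \<open>{1, 2}\<close>, the
  symbol deciding which of them is the large one: symbol 1 enlarges the second, 2 the third and
  3 the first. Regrouping the product as \<open>(a - c') + (b - a') + (c - b')\<close>, the three terms vanish
  exactly if the symbols of the three permutations are 1, 2 and 3 respectively, so that
  \<^const>\<open>exactly_two\<close> leaves a single nonzero term.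
\<close>

definition usp_factor :: "nat \<Rightarrow> (nat \<Rightarrow> nat) \<times> nat \<Rightarrow> ((nat \<Rightarrow> nat) \<Rightarrow> nat \<Rightarrow> nat) \<Rightarrow> int set" where
  "usp_factor s = (\<lambda>(u, i) \<pi>. if \<pi> u i = s then {1, 2} else {0})"

lemma usp_factor_sum_nonzero:
  fixes x y z :: nat and a a' b b' c c' :: int
  assumes two: "exactly_two (x = 1) (y = 2) (z = 3)" and "x \<in> {1, 2, 3}" "y \<in> {1, 2, 3}" "z \<in> {1, 2, 3}"
    and "a \<in> (if x = 3 then {1, 2} else {0})" "a' \<in> (if y = 3 then {1, 2} else {0})"
    and "b \<in> (if y = 1 then {1, 2} else {0})" "b' \<in> (if z = 1 then {1, 2} else {0})"
    and "c \<in> (if z = 2 then {1, 2} else {0})" "c' \<in> (if x = 2 then {1, 2} else {0})"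
  shows "(a - a' + (b - b') + (c - c')) mod 3 \<noteq> 0"
proof -
  \<comment> \<open>A symbol other than 1 enlarges exactly one of the sets of \<open>a\<close> and
    \<open>c'\<close>, so the difference is 1 or 2 up to sign. The other two pairs behave alike with
    the symbols 2 and 3.\<close>
  have "if x = 1 then a - c' = 0 else a - c' \<in> {1, 2, -1, -2}"
    using assms(2,5,10) by (auto split: if_splits)
  moreover have "if y = 2 then b - a' = 0 else b - a' \<in> {1, 2, -1, -2}"
    using assms(3,6,7) by (auto split: if_splits)
  moreover have "if z = 3 then c - b' = 0 else c - b' \<in> {1, 2, -1, -2}"
    using assms(4,8,9) by (auto split: if_splits)
  ultimately have "(a - c') + (b - a') + (c - b') \<in> {1, 2, -1, -2}"
    using two unfolding exactly_two_def by (elim disjE conjE) simp_all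
  moreover have "a - a' + (b - b') + (c - c') = (a - c') + (b - a') + (c - b')" by simp
  ultimately have "a - a' + (b - b') + (c - c') \<in> {1, 2, -1, -2}" by (simp only:)
  then show ?thesis by auto
qed

lemma strong_USP_value:
  assumes "strong_USP k U" "u \<in> U" "i \<in> {1..k}"
  shows "u i \<in> {1, 2, 3}"
proof -
  have "u \<in> {1..k} \<rightarrow>\<^sub>E {1, 2, 3}" using assms(1,2) unfolding strong_USP_def by auto
  then show ?thesis using assms(3) by (rule PiE_mem)
qed

text \<open>Every row \<open>u\<close> and column \<open>i\<close> get one coordinate, in which
  \<pi> contributes the symbol \<open>\<pi> u i\<close>. For a single permutation only one of the
  three sets there has two elements, so only one difference remains, and its vanishing modulo 3
  forces equality.\<close>

lemma stpp_of_strong_USP: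
  assumes "strong_USP k U"
  shows "stpp (product_group (U \<times> {1..k}) (\<lambda>_. integer_mod_group 3)) {\<pi>. \<pi> permutes U}
    (\<lambda>\<pi>. \<Pi>\<^sub>E w\<in>U \<times> {1..k}. usp_factor 3 w \<pi>) (\<lambda>\<pi>. \<Pi>\<^sub>E w\<in>U \<times> {1..k}. usp_factor 1 w \<pi>)
    (\<lambda>\<pi>. \<Pi>\<^sub>E w\<in>U \<times> {1..k}. usp_factor 2 w \<pi>)"
proof (rule comm_group.stpp_power[OF abelian_integer_mod_group])
  have sub: "usp_factor s w \<pi> \<subseteq> {0, 1, 2}" for s w \<pi> by (auto simp: usp_factor_def split: prod.splits)
  moreover have "{0, 1, 2} \<subseteq> carrier (integer_mod_group 3)" by (auto simp: carrier_integer_mod_group)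
  ultimately show "usp_factor 3 w \<pi> \<subseteq> carrier (integer_mod_group 3) \<and> usp_factor 1 w \<pi> \<subseteq> carrier (integer_mod_group 3) \<and>
      usp_factor 2 w \<pi> \<subseteq> carrier (integer_mod_group 3)" for w \<pi>
    by (meson subset_trans)
  have val: "\<pi> u i \<in> {1, 2, 3}" if "\<pi> permutes U" "u \<in> U" "i \<in> {1..k}" for \<pi> u i
    by (rule strong_USP_value[OF assms _ that(3)]) (use that(1,2) in \<open>simp add: permutes_in_image\<close>)
  {
    fix \<pi>1 \<pi>2 \<pi>3
    assume perm: "\<pi>1 \<in> {\<pi>. \<pi> permutes U}" "\<pi>2 \<in> {\<pi>. \<pi> permutes U}" "\<pi>3 \<in> {\<pi>. \<pi> permutes U}"
      and ex: "\<And>w. w \<in> U \<times> {1..k} \<Longrightarrow> \<exists>a\<in>usp_factor 3 w \<pi>1. \<exists>a'\<in>usp_factor 3 w \<pi>2.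
        \<exists>b\<in>usp_factor 1 w \<pi>2. \<exists>b'\<in>usp_factor 1 w \<pi>3. \<exists>c\<in>usp_factor 2 w \<pi>3. \<exists>c'\<in>usp_factor 2 w \<pi>1.
        tri (integer_mod_group 3) a a' b b' c c' = \<one>\<^bsub>integer_mod_group 3\<^esub>"
    show "\<pi>1 = \<pi>2 \<and> \<pi>2 = \<pi>3"
    proof (rule ccontr)
      assume "\<not> (\<pi>1 = \<pi>2 \<and> \<pi>2 = \<pi>3)"
      then obtain u i where ui: "u \<in> U" "i \<in> {1..k}" "exactly_two (\<pi>1 u i = 1) (\<pi>2 u i = 2) (\<pi>3 u i = 3)"
        using assms perm unfolding strong_USP_def by blast
      obtain a a' b b' c c' where mem: "a \<in> usp_factor 3 (u, i) \<pi>1" "a' \<in> usp_factor 3 (u, i) \<pi>2"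
        "b \<in> usp_factor 1 (u, i) \<pi>2" "b' \<in> usp_factor 1 (u, i) \<pi>3"
        "c \<in> usp_factor 2 (u, i) \<pi>3" "c' \<in> usp_factor 2 (u, i) \<pi>1"
        and tri: "tri (integer_mod_group 3) a a' b b' c c' = \<one>\<^bsub>integer_mod_group 3\<^esub>"
        using ex[of "(u, i)"] ui by blast
      have "{a, a', b, b', c, c'} \<subseteq> {0, 1, 2}" using mem sub by blast
      then have "(a - a' + (b - b') + (c - c')) mod 3 = 0" using tri tri_mod_3 by simp
      moreover have "(a - a' + (b - b') + (c - c')) mod 3 \<noteq> 0"
        using mem val[OF _ ui(1,2)] perm unfolding usp_factor_def prod.case
        by (intro usp_factor_sum_nonzero[OF ui(3)]) auto
      ultimately show False by simp
    qed
  }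
  fix \<pi> w a a' b b' c c'
  assume perm: "\<pi> \<in> {\<pi>. \<pi> permutes U}" and w: "w \<in> U \<times> {1..k}"
    and mem: "a \<in> usp_factor 3 w \<pi>" "a' \<in> usp_factor 3 w \<pi>" "b \<in> usp_factor 1 w \<pi>"
      "b' \<in> usp_factor 1 w \<pi>" "c \<in> usp_factor 2 w \<pi>" "c' \<in> usp_factor 2 w \<pi>"
    and tri: "tri (integer_mod_group 3) a a' b b' c c' = \<one>\<^bsub>integer_mod_group 3\<^esub>"
  obtain u i where ui: "w = (u, i)" by (cases w)
  have "{a, a', b, b', c, c'} \<subseteq> {0, 1, 2}" using mem sub by blast
  then have *: "(a - a' + (b - b') + (c - c')) mod 3 = 0" using tri tri_mod_3 by simp
  have "\<pi> u i \<in> {1, 2, 3}" using val perm w ui by auto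
  then consider "\<pi> u i = 1" | "\<pi> u i = 2" | "\<pi> u i = 3" by blast
  then show "a = a' \<and> b = b' \<and> c = c'"
    by cases (use * mem ui in \<open>auto simp: usp_factor_def\<close>)
qed

text \<open>Permuting the rows only reorders the outer product, so the sizes are the same throughout
  the family.\<close>

lemma card_usp_factors:
  assumes "finite U" "\<pi> permutes U"
  shows "card (\<Pi>\<^sub>E w\<in>U \<times> {1..k}. usp_factor s w \<pi>) = (\<Prod>u\<in>U. \<Prod>i\<in>{1..k}. if u i = s then 2 else 1)"
proof -
  have "card (\<Pi>\<^sub>E w\<in>U \<times> {1..k}. usp_factor s w \<pi>) = (\<Prod>w\<in>U \<times> {1..k}. card (usp_factor s w \<pi>))"
    using assms(1) by (intro card_PiE) auto
  also have "\<dots> = (\<Prod>(u, i)\<in>U \<times> {1..k}. if \<pi> u i = s then 2 else 1)"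
    by (intro prod.cong) (auto simp: usp_factor_def)
  also have "\<dots> = (\<Prod>u\<in>U. \<Prod>i\<in>{1..k}. if \<pi> u i = s then 2 else 1)"
    by (rule prod.cartesian_product[symmetric])
  also have "\<dots> = (\<Prod>u\<in>U. \<Prod>i\<in>{1..k}. if u i = s then 2 else 1)"
    using prod.permute[OF assms(2), of "\<lambda>u. \<Prod>i\<in>{1..k}. if u i = s then 2 else (1::nat)"] by (simp add: comp_def)
  finally show ?thesis .
qed

lemma finite_strong_USP: "strong_USP k U \<Longrightarrow> finite U"
  unfolding strong_USP_def by (meson finite_PiE finite_atLeastAtMost finite.intros finite_subset)

text \<open>Every position doubles exactly one of the three sets, so the product of the sizes is
  \<open>2 ^ (k * card U)\<close>. The hypothesis \<open>le\<close> is the single-block inequality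
  for \<open>g = 3 ^ k\<close> and \<open>t = 2 ^ k\<close>.\<close>

lemma matmul_in_O_powr_of_strong_USP:
  assumes usp: "strong_USP k U"
    and \<sigma>: "2 \<le> \<sigma>" "\<sigma> < \<tau>"
    and le: "3 ^ k \<le> real (card U) / exp 1 * (2 ^ k) powr (\<sigma> / 3)"
    and large: "real k * (\<tau> - \<sigma>) \<ge> 1"
  shows "matmul_in_O_powr \<tau>"
proof -
  let ?G = "integer_mod_group 3" and ?W = "U \<times> {1..k}"
  define P where "P s = (\<Prod>u\<in>U. \<Prod>i\<in>{1..k}. if u i = s then 2 else (1::nat))" for s
  have U: "finite U" using usp by (rule finite_strong_USP)
  have "card U > 0"
  proof (rule ccontr)
    assume "\<not> card U > 0"
    then have "3 ^ k \<le> (0::real)" using le by simp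
    moreover have "(0::real) < 3 ^ k" by simp
    ultimately show False by linarith
  qed
  have uk: "u i \<in> {1, 2, 3}" if "u \<in> U" "i \<in> {1..k}" for u i
    using strong_USP_value[OF usp that] .
  have P: "P 3 * P 1 * P 2 = 2 ^ (k * card U)"
  proof -
    have "P 3 * P 1 * P 2 = (\<Prod>u\<in>U. \<Prod>i\<in>{1..k}. (if u i = 3 then 2 else 1) * (if u i = 1 then 2 else 1) *
        (if u i = 2 then 2 else 1))"
      by (simp add: P_def prod.distrib)
    also have "\<dots> = (\<Prod>u\<in>U. \<Prod>i\<in>{1..k}. 2)"
      by (intro prod.cong refl) (use uk in force)
    finally show ?thesis by (simp add: power_mult)
  qed
  have fin: "finite (carrier (product_group ?W (\<lambda>_. ?G)))"
    using U by (auto simp: carrier_integer_mod_group intro!: finite_PiE)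
  have "(3 ^ k) ^ card U \<le> fact (card U) * (real (P 3 * P 1 * P 2)) powr (\<sigma> / 3)"
  proof (rule permutation_power_bound[OF _ _ _ le])
    show "(2 ^ k) ^ card U \<le> real (P 3 * P 1 * P 2)" unfolding P by (simp add: power_mult)
  qed (use \<sigma> in auto)
  moreover have "order ?G = 3" by (simp add: order_def carrier_integer_mod_group)
  then have "order (product_group ?W (\<lambda>_. ?G)) = (3 ^ k) ^ card U"
    using U by (simp add: order_power_group card_cartesian_product mult.commute flip: power_mult)
  ultimately have bound: "real (order (product_group ?W (\<lambda>_. ?G))) \<le>
      real (card {\<pi>. \<pi> permutes U}) * (real (P 3 * P 1 * P 2)) powr (\<sigma> / 3)"
    using U by (simp add: card_permutations)
  have "real k * (\<tau> - \<sigma>) * 1 \<le> real k * (\<tau> - \<sigma>) * real (card U)"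
    using \<open>card U > 0\<close> \<sigma> by (intro mult_left_mono) auto
  then have "2 powr 1 \<le> (2::real) powr (real (k * card U) * (\<tau> - \<sigma>))"
    using large by (intro powr_mono) (auto simp: mult_ac)
  then have "2 \<le> (2 powr real (k * card U)) powr (\<tau> - \<sigma>)" by (simp add: powr_powr)
  also have "(2::real) powr real (k * card U) = real (P 3 * P 1 * P 2)"
    unfolding P by (subst powr_realpow) auto
  finally have large': "2 \<le> real (P 3 * P 1 * P 2) powr (\<tau> - \<sigma>)" .
  show ?thesis
    by (rule comm_group.matmul_in_O_powr_of_stpp[OF comm_group.comm_group_power[OF abelian_integer_mod_group]
        fin _ _ stpp_of_strong_USP[OF usp] _ _ _ bound \<sigma> large'])
      (use U in \<open>auto simp: finite_permutations P_def card_usp_factors[simplified] intro: permutes_id\<close>)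
qed

section \<open>Achievable constants and the capacity\<close>

lemma strong_USP_achievable_one: "strong_USP_achievable 1"
  unfolding strong_USP_achievable_def
proof (intro exI conjI allI)
  show "strict_mono (\<lambda>m::nat. m)" by (simp add: strict_mono_def)
  show "(\<lambda>m. 0::real) \<longlonglongrightarrow> 0" by simp
  fix m
  \<comment> \<open>A single row admits only the identity, so three permutations always
    agree.\<close>
  show "strong_USP m {\<lambda>i\<in>{1..m}. 1}" by (auto simp: strong_USP_def)
  show "real (card {\<lambda>i\<in>{1..m}. 1 :: nat}) = (1 - 0) ^ m" by simp
qed

lemma card_strong_USP_le: "strong_USP k U \<Longrightarrow> card U \<le> 3 ^ k"
proof -
  assume "strong_USP k U"
  then have "U \<subseteq> {1..k} \<rightarrow>\<^sub>E {1, 2, 3}" by (simp add: strong_USP_def)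
  then have "card U \<le> card ({1..k} \<rightarrow>\<^sub>E {1, 2, 3 :: nat})" by (intro card_mono finite_PiE) auto
  then show ?thesis by (simp add: card_PiE numeral_3_eq_3)
qed

text \<open>The sequences of the definition are traded for one puzzle of arbitrarily large width
  \<open>k\<close> whose rate \<open>x\<close> is close to \<open>C\<close>.\<close>

lemma strong_USP_achievable_frequently:
  assumes "strong_USP_achievable C" "\<epsilon> > 0"
  shows "\<exists>k>K. \<exists>U x. strong_USP k U \<and> real (card U) = x ^ k \<and> \<bar>x - C\<bar> < \<epsilon>"
proof -
  obtain k U e where *: "strict_mono k" "e \<longlonglongrightarrow> 0"
    "\<And>m. strong_USP (k m) (U m) \<and> real (card (U m)) = (C - e m) ^ k m"
    using assms(1) unfolding strong_USP_achievable_def by blast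
  have "\<forall>\<^sub>F m in sequentially. \<bar>e m\<bar> < \<epsilon>"
    using tendstoD[OF *(2) assms(2)] by (simp add: dist_real_def)
  moreover have "\<forall>\<^sub>F m in sequentially. m > K" by (rule eventually_gt_at_top)
  ultimately obtain m where m: "\<bar>e m\<bar> < \<epsilon>" "m > K"
    using eventually_happens'[OF sequentially_bot eventually_conj] by blast
  moreover have "k m \<ge> m" using *(1) by (rule seq_suble)
  ultimately show ?thesis using *(3)[of m] by (intro exI[of _ "k m"] conjI exI[of _ "U m"] exI[of _ "C - e m"]) auto
qed

lemma strong_USP_achievable_le_3:
  assumes "strong_USP_achievable C"
  shows "C \<le> 3"
proof (rule ccontr)
  assume "\<not> C \<le> 3"
  then obtain k U x where k: "k > 0" "strong_USP k U" "real (card U) = x ^ k" "\<bar>x - C\<bar> < C - 3"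
    using strong_USP_achievable_frequently[OF assms, of "C - 3" 0] by auto
  then have "3 ^ k < x ^ k" by (intro power_strict_mono) auto
  moreover have "real (card U) \<le> 3 ^ k" using card_strong_USP_le[OF k(2)] by (metis of_nat_le_iff of_nat_numeral of_nat_power)
  ultimately show False using k by simp
qed

text \<open>A diagonal choice: puzzle number \<open>m\<close> belongs to an achievable constant
  within \<open>1 / (2 (m + 1))\<close> of \<open>C\<close>, its own rate is as close to that
  constant, and its width exceeds the previous one.\<close>

lemma strong_USP_achievable_closed:
  assumes appr: "\<And>\<epsilon>. \<epsilon> > 0 \<Longrightarrow> \<exists>C'. strong_USP_achievable C' \<and> \<bar>C' - C\<bar> < \<epsilon>"
  shows "strong_USP_achievable C"
proof -
  define P where "P m k U x \<longleftrightarrow> strong_USP k U \<and> real (card U) = x ^ k \<and> \<bar>x - C\<bar> < inverse (real (Suc m))"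
    for m k and U :: "(nat \<Rightarrow> nat) set" and x :: real
  have ex: "\<exists>k>K. \<exists>U x. P m k U x" for m K
  proof -
    have pos: "inverse (real (Suc m)) / 2 > 0" by simp
    obtain C' where C': "strong_USP_achievable C'" "\<bar>C' - C\<bar> < inverse (real (Suc m)) / 2"
      using appr[OF pos] by blast
    obtain k U x where "k > K" "strong_USP k U" "real (card U) = x ^ k" "\<bar>x - C'\<bar> < inverse (real (Suc m)) / 2"
      using strong_USP_achievable_frequently[OF C'(1) pos] by blast
    moreover from this C'(2) have "\<bar>x - C\<bar> < inverse (real (Suc m))" by linarith
    ultimately show ?thesis unfolding P_def by blast
  qed
  have "\<exists>k. \<forall>m. (\<exists>U x. P m (k m) U x) \<and> k m < k (Suc m)"
    by (rule dependent_nat_choice) (use ex in blast)+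
  then obtain k where k: "\<And>m. \<exists>U x. P m (k m) U x" "\<And>m. k m < k (Suc m)" by blast
  then obtain U x where U: "\<And>m. P m (k m) (U m) (x m)" by metis
  have "(\<lambda>m. C - x m) \<longlonglongrightarrow> 0"
    by (rule LIMSEQ_norm_0) (use U in \<open>simp add: P_def abs_minus_commute inverse_eq_divide\<close>)
  then show ?thesis unfolding strong_USP_achievable_def
    using U k(2) by (intro exI[of _ k] exI[of _ U] exI[of _ "\<lambda>m. C - x m"]) (auto simp: P_def strict_mono_Suc_iff)
qed

text \<open>A \<open>GREATEST\<close> is meaningful only if the maximum exists: the achievable constants form a closed bounded set.\<close>

lemma strong_USP_achievable_capacity: "strong_USP_achievable strong_USP_capacity"
proof -
  let ?S = "{C. strong_USP_achievable C}"
  have ne: "?S \<noteq> {}" and bdd: "bdd_above ?S"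
    using strong_USP_achievable_one strong_USP_achievable_le_3 by (auto intro!: bdd_aboveI[of _ 3])
  have le: "C \<le> Sup ?S" if "strong_USP_achievable C" for C
    using that bdd by (intro cSup_upper) auto
  have "strong_USP_achievable (Sup ?S)"
  proof (rule strong_USP_achievable_closed)
    fix \<epsilon> :: real assume "\<epsilon> > 0"
    then obtain C' where "strong_USP_achievable C'" "Sup ?S - \<epsilon> < C'"
      using less_cSupD[OF ne, of "Sup ?S - \<epsilon>"] by auto
    then show "\<exists>C'. strong_USP_achievable C' \<and> \<bar>C' - Sup ?S\<bar> < \<epsilon>"
      using le[of C'] by (intro exI[of _ C']) auto
  qed
  moreover from this le have "strong_USP_capacity = Sup ?S"
    unfolding strong_USP_capacity_def by (intro Greatest_equality)
  ultimately show ?thesis by simp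
qed

lemma matmul_exponent_of_capacity:
  assumes "strong_USP_achievable (3 / 2 powr (2 / 3))"
  shows "matmul_exponent = 2"
proof (rule matmul_exponent_eq_2)
  fix \<tau> :: real assume "\<tau> > 2"
  define \<sigma> where "\<sigma> = (2 + \<tau>) / 2"
  have \<sigma>: "2 < \<sigma>" "\<sigma> < \<tau>" using \<open>\<tau> > 2\<close> by (auto simp: \<sigma>_def)
  let ?C = "3 / 2 powr (2 / 3) :: real"
  \<comment> \<open>Raising the exponent from 2 to \<sigma> gains a factor \<open>\<rho>^2\<close>
    per column. One \<rho> covers the distance between the rate \<open>x\<close> and the capacity;
    the other, through \<open>\<rho>^k \<ge> e\<close>, covers the \<open>e\<close> from counting
    permutations.\<close>
  define \<rho> :: real where "\<rho> = 2 powr ((\<sigma> - 2) / 6)"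
  have "\<rho> > 1" using \<sigma> by (simp add: \<rho>_def)
  have "?C * 2 powr (\<sigma> / 3) = 3 * 2 powr (\<sigma> / 3 - 2 / 3)" by (simp add: powr_diff)
  also have "\<sigma> / 3 - 2 / 3 = (\<sigma> - 2) / 6 + (\<sigma> - 2) / 6" by (simp add: field_simps)
  finally have C: "?C * 2 powr (\<sigma> / 3) = 3 * \<rho> * \<rho>" by (simp only: \<rho>_def powr_add mult.assoc)
  have "3 * \<rho> / 2 powr (\<sigma> / 3) < ?C" using C \<open>\<rho> > 1\<close> by (simp add: field_simps)
  then have eps: "?C - 3 * \<rho> / 2 powr (\<sigma> / 3) > 0" by simp
  obtain K1 where K1: "exp 1 < \<rho> ^ K1" using \<open>\<rho> > 1\<close> real_arch_pow by blast
  obtain K2 :: nat where K2: "1 < K2 * (\<tau> - \<sigma>)" using \<sigma> reals_Archimedean3[of "\<tau> - \<sigma>"] by (auto simp: mult.commute)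
  obtain k U x where k: "k > max K1 K2" "strong_USP k U" "real (card U) = x ^ k"
    "\<bar>x - ?C\<bar> < ?C - 3 * \<rho> / 2 powr (\<sigma> / 3)"
    using strong_USP_achievable_frequently[OF assms eps] by blast
  have "3 * \<rho> / 2 powr (\<sigma> / 3) < x" using k(4) by linarith
  then have x: "3 * \<rho> \<le> x * 2 powr (\<sigma> / 3)" by (simp add: field_simps)
  show "matmul_in_O_powr \<tau>"
  proof (rule matmul_in_O_powr_of_strong_USP[OF k(2) less_imp_le[OF \<sigma>(1)] \<sigma>(2)])
    have "exp 1 \<le> \<rho> ^ k"
    proof -
      have "\<rho> ^ K1 \<le> \<rho> ^ k" using k(1) \<open>\<rho> > 1\<close> by (intro power_increasing) auto
      then show ?thesis using K1 by linarith
    qed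
    then have "3 ^ k * exp 1 \<le> 3 ^ k * \<rho> ^ k" by simp
    also have "\<dots> = (3 * \<rho>) ^ k" by (simp add: power_mult_distrib)
    also have "\<dots> \<le> (x * 2 powr (\<sigma> / 3)) ^ k" using x \<open>\<rho> > 1\<close> by (intro power_mono) auto
    also have "\<dots> = card U * (2 ^ k) powr (\<sigma> / 3)"
      using k(3) by (simp add: power_mult_distrib powr_powr mult.commute flip: powr_realpow)
    finally show "3 ^ k \<le> real (card U) / exp 1 * (2 ^ k) powr (\<sigma> / 3)" by (simp add: field_simps)
    have "K2 * (\<tau> - \<sigma>) \<le> k * (\<tau> - \<sigma>)" using k(1) \<sigma> by (intro mult_right_mono) auto
    then show "1 \<le> real k * (\<tau> - \<sigma>)" using K2 by linarith
  qed
qed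

section \<open>The simultaneous double product property\<close>

text \<open>
  \<open>triangle_points\<close> is the index set of the construction for the double product property. The
  triple attached to \<open>(x, y, z)\<close> is \<open>A x \<times> 1 \<times> B z\<close>, \<open>B x \<times> A y \<times> 1\<close>, \<open>1 \<times> B y \<times> A z\<close>.
\<close>

definition coord :: "nat \<Rightarrow> nat \<times> nat \<times> nat \<Rightarrow> nat" where
  "coord c = (\<lambda>(x, y, z). if c = 0 then x else if c = 1 then y else z)"

definition triangle_points :: "nat \<Rightarrow> (nat \<times> nat \<times> nat) set" where
  "triangle_points n = {(x, y, z). 1 \<le> x \<and> 1 \<le> y \<and> 1 \<le> z \<and> x + y + z = n + 2}"

lemma coord_eqI: "coord 0 v = coord 0 w \<Longrightarrow> coord 1 v = coord 1 w \<Longrightarrow> coord 2 v = coord 2 w \<Longrightarrow> v = w"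
  by (cases v; cases w) (auto simp: coord_def)

text \<open>The other two coordinates are at least 1, so the total \<open>n + 2\<close> is what
  makes each coordinate an index of one of the \<open>n\<close> pairs.\<close>

lemma triangle_points_coord: "v \<in> triangle_points n \<Longrightarrow> coord c v \<in> {1..n}"
  by (auto simp: triangle_points_def coord_def)

lemma triangle_points_sum: "v \<in> triangle_points n \<Longrightarrow> coord 0 v + coord 1 v + coord 2 v = n + 2"
  by (auto simp: triangle_points_def coord_def)

lemma triangle_points_eq_image:
  "triangle_points n = (\<lambda>(x, y). (x, y, n + 2 - x - y)) ` (SIGMA x:{1..n}. {1..n + 1 - x})"
  by (force simp: triangle_points_def image_iff)

lemma finite_triangle_points: "finite (triangle_points n)"
  by (simp add: triangle_points_eq_image)

lemma card_triangle_points: "card (triangle_points n) = n * (n + 1) div 2"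
proof -
  have "card (triangle_points n) = card (SIGMA x:{1..n}. {1..n + 1 - x})"
    unfolding triangle_points_eq_image by (intro card_image) (auto simp: inj_on_def)
  also have "\<dots> = (\<Sum>x\<in>{1..n}. n + 1 - x)" by simp
  also have "\<dots> = \<Sum>{1..n}"
    by (rule sum.reindex_bij_witness[of _ "\<lambda>x. n + 1 - x" "\<lambda>x. n + 1 - x"]) auto
  also have "\<dots> = n * (n + 1) div 2" by (simp add: Sum_Icc_nat)
  finally show ?thesis .
qed

lemma triangle_permutations_eq:
  assumes p: "p1 permutes triangle_points n" "p2 permutes triangle_points n" "p3 permutes triangle_points n"
    and c0: "\<And>v. v \<in> triangle_points n \<Longrightarrow> coord 0 (p1 v) = coord 0 (p3 v)"
    and c1: "\<And>v. v \<in> triangle_points n \<Longrightarrow> coord 1 (p2 v) = coord 1 (p1 v)"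
    and c2: "\<And>v. v \<in> triangle_points n \<Longrightarrow> coord 2 (p3 v) = coord 2 (p2 v)"
  shows "p1 = p2 \<and> p2 = p3"
proof -
  define f where "f c v = int (coord c v)" for c v
  define s where "s = int n + 2"
  \<comment> \<open>Let \<open>x\<close> be the first coordinate shared by the images under
    \<open>p1\<close> and \<open>p3\<close>, \<open>y\<close> the second one shared by
    \<open>p1\<close> and \<open>p2\<close>, \<open>z\<close> the third one shared by
    \<open>p2\<close> and \<open>p3\<close>. They exceed the fixed sum \<open>s\<close> by
    \<open>d\<close>, so the three images are \<open>(x, y, z - d)\<close>,
    \<open>(x - d, y, z)\<close> and \<open>(x, y - d, z)\<close>. The differences of squares then
    add up to \<open>2 s d - d^2\<close>.\<close>
  define d where "d v = f 0 (p1 v) + f 1 (p1 v) + f 2 (p2 v) - s" for v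
  have mem: "p1 v \<in> triangle_points n" "p2 v \<in> triangle_points n" "p3 v \<in> triangle_points n" if "v \<in> triangle_points n" for v
    using p that by (auto simp: permutes_in_image)
  have sum: "f 0 v + f 1 v + f 2 v = s" if "v \<in> triangle_points n" for v
    using triangle_points_sum[OF that] unfolding f_def s_def by linarith
  have d: "f 0 (p2 v) = f 0 (p1 v) - d v" "f 1 (p3 v) = f 1 (p1 v) - d v" "f 2 (p1 v) = f 2 (p2 v) - d v"
    if "v \<in> triangle_points n" for v
    using sum[OF mem(1)[OF that]] sum[OF mem(2)[OF that]] sum[OF mem(3)[OF that]] c0[OF that] c1[OF that] c2[OF that]
    by (auto simp: d_def f_def)
  have inv: "(\<Sum>v\<in>triangle_points n. g (q v)) = (\<Sum>v\<in>triangle_points n. g v)" if "q permutes triangle_points n"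
    for q and g :: "_ \<Rightarrow> int"
    using sum.permute[OF that, of g] by (simp add: comp_def)
  txt \<open>Since the sums of the coordinates and of their squares are invariant under permutations,
    the sum of the \<open>(d v)\<^sup>2\<close> vanishes.\<close>
  have "(d v)\<^sup>2 = 2 * s * (f 0 (p1 v) - f 0 (p2 v)) - ((f 0 (p1 v))\<^sup>2 - (f 0 (p2 v))\<^sup>2)
      - ((f 1 (p1 v))\<^sup>2 - (f 1 (p3 v))\<^sup>2) - ((f 2 (p2 v))\<^sup>2 - (f 2 (p1 v))\<^sup>2)"
    if "v \<in> triangle_points n" for v
  proof -
    have s: "s = f 0 (p1 v) + f 1 (p1 v) + f 2 (p2 v) - d v" by (simp add: d_def)
    show ?thesis unfolding d[OF that] unfolding s by (simp add: power2_eq_square algebra_simps)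
  qed
  then have "(\<Sum>v\<in>triangle_points n. (d v)\<^sup>2) = (\<Sum>v\<in>triangle_points n. 2 * s * (f 0 (p1 v) - f 0 (p2 v)) -
      ((f 0 (p1 v))\<^sup>2 - (f 0 (p2 v))\<^sup>2) - ((f 1 (p1 v))\<^sup>2 - (f 1 (p3 v))\<^sup>2) - ((f 2 (p2 v))\<^sup>2 - (f 2 (p1 v))\<^sup>2))"
    by (rule sum.cong[OF refl])
  also have "\<dots> = 0"
    using inv[OF p(1), of "f 0"] inv[OF p(2), of "f 0"]
      inv[OF p(1), of "\<lambda>v. (f 0 v)\<^sup>2"] inv[OF p(2), of "\<lambda>v. (f 0 v)\<^sup>2"]
      inv[OF p(1), of "\<lambda>v. (f 1 v)\<^sup>2"] inv[OF p(3), of "\<lambda>v. (f 1 v)\<^sup>2"]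
      inv[OF p(2), of "\<lambda>v. (f 2 v)\<^sup>2"] inv[OF p(1), of "\<lambda>v. (f 2 v)\<^sup>2"]
    by (simp add: sum_subtractf flip: sum_distrib_left)
  finally have "\<forall>v\<in>triangle_points n. (d v)\<^sup>2 = 0"
    by (subst (asm) sum_nonneg_eq_0_iff) (auto simp: finite_triangle_points)
  then have "p1 v = p2 v \<and> p2 v = p3 v" if "v \<in> triangle_points n" for v
    using d[OF that] c0[OF that] c1[OF that] c2[OF that] that by (auto simp: f_def intro!: coord_eqI)
  moreover have "p1 v = p2 v \<and> p2 v = p3 v" if "v \<notin> triangle_points n" for v
    using p that by (auto simp: permutes_not_in)
  ultimately show ?thesis by blast
qed

context comm_group
begin

text \<open>For \<open>j = i\<close> the first conclusion gives \<open>k = i\<close>, so all four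
  elements belong to one pair and its own double product property applies.\<close>

lemma sdppD:
  assumes sdpp: "simultaneous_double_product_property G n A B"
    and ijk: "i \<in> {1..n}" "j \<in> {1..n}" "k \<in> {1..n}"
    and mem: "a \<in> A i" "a' \<in> A j" "b \<in> B j" "b' \<in> B k"
    and eq: "a \<otimes> inv a' \<otimes> (b \<otimes> inv b') = \<one>"
  shows "i = k" and "j = i \<Longrightarrow> a = a' \<and> b = b'"
proof -
  have sub: "A i \<subseteq> carrier G" "A j \<subseteq> carrier G" "B j \<subseteq> carrier G" "B k \<subseteq> carrier G"
    and dpp: "double_product_property G (A i) (B i)"
    using sdpp ijk unfolding simultaneous_double_product_property_def by blast+
  have car: "a \<in> carrier G" "a' \<in> carrier G" "b \<in> carrier G" "b' \<in> carrier G"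
    using sub mem by auto
  have "a \<otimes> inv a' \<otimes> b \<otimes> inv b' = \<one>" using eq car by (simp add: m_assoc)
  then show "i = k" using sdpp ijk mem unfolding simultaneous_double_product_property_def by blast
  assume "j = i"
  then have "a \<otimes> inv a' \<in> right_quotients G (A i)" "b \<otimes> inv b' \<in> right_quotients G (B i)"
    using mem \<open>i = k\<close> unfolding right_quotients_def by blast+
  then have "a \<otimes> inv a' = \<one>" "b \<otimes> inv b' = \<one>"
    using dpp eq unfolding double_product_property_def by blast+
  then show "a = a' \<and> b = b'" using car by (metis inv_closed inv_equality inv_inv)
qed

text \<open>Here \<open>r\<close> is the coordinate that carries an \<open>A\<close> and
  \<open>s\<close> the one that carries a \<open>B\<close>. With \<open>(r, s)\<close> equal to (0,
  2), (1, 0) and (2, 1) for the three subsets, every coordinate sees one \<open>A\<close>, one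
  \<open>B\<close> and one trivial set.\<close>

definition sdpp_factor ::
    "(nat \<Rightarrow> 'a set) \<Rightarrow> (nat \<Rightarrow> 'a set) \<Rightarrow> nat \<Rightarrow> nat \<Rightarrow> (nat \<times> nat \<times> nat) \<times> nat \<Rightarrow>
     (nat \<times> nat \<times> nat \<Rightarrow> nat \<times> nat \<times> nat) \<Rightarrow> 'a set" where
  "sdpp_factor A B r s = (\<lambda>(v, c) \<pi>. if c = r then A (coord c (\<pi> v)) else if c = s then B (coord c (\<pi> v)) else {\<one>})"

text \<open>In each coordinate one quotient is trivial, and in the remaining relation the
  \<open>A\<close> part leads from one permutation to a second, the \<open>B\<close> part from the
  second to the third. This equates the coordinate for the first and the third only; the three
  relations obtained cyclically are the hypotheses of
  \<open>triangle_permutations_eq\<close>.\<close>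

lemma stpp_of_sdpp:
  assumes sdpp: "simultaneous_double_product_property G n A B"
  shows "stpp (product_group (triangle_points n \<times> {0, 1, 2}) (\<lambda>_. G)) {\<pi>. \<pi> permutes triangle_points n}
    (\<lambda>\<pi>. \<Pi>\<^sub>E w\<in>triangle_points n \<times> {0, 1, 2}. sdpp_factor A B 0 2 w \<pi>)
    (\<lambda>\<pi>. \<Pi>\<^sub>E w\<in>triangle_points n \<times> {0, 1, 2}. sdpp_factor A B 1 0 w \<pi>)
    (\<lambda>\<pi>. \<Pi>\<^sub>E w\<in>triangle_points n \<times> {0, 1, 2}. sdpp_factor A B 2 1 w \<pi>)"
proof (rule stpp_power)
  have sub: "A i \<subseteq> carrier G" "B i \<subseteq> carrier G" if "i \<in> {1..n}" for i
    using sdpp that unfolding simultaneous_double_product_property_def by blast+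
  have co: "coord c (\<pi> v) \<in> {1..n}" if "\<pi> permutes triangle_points n" "v \<in> triangle_points n" for c \<pi> v
    using that by (intro triangle_points_coord) (simp add: permutes_in_image)
  have fsub: "sdpp_factor A B r s w \<pi> \<subseteq> carrier G" if "w \<in> triangle_points n \<times> {0, 1, 2}" "\<pi> \<in> {\<pi>. \<pi> permutes triangle_points n}" for r s w \<pi>
  proof -
    from that(1) obtain v c where w: "w = (v, c)" "v \<in> triangle_points n" by auto
    then show ?thesis using sub[OF co, of \<pi> v c] that(2) by (auto simp: sdpp_factor_def)
  qed
  then show "sdpp_factor A B 0 2 w \<pi> \<subseteq> carrier G \<and> sdpp_factor A B 1 0 w \<pi> \<subseteq> carrier G \<and> sdpp_factor A B 2 1 w \<pi> \<subseteq> carrier G"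
    if "w \<in> triangle_points n \<times> {0, 1, 2}" "\<pi> \<in> {\<pi>. \<pi> permutes triangle_points n}" for w \<pi> using that by blast
  have simps: "sdpp_factor A B r s (v, c) \<pi> =
     (if c = r then A (coord c (\<pi> v)) else if c = s then B (coord c (\<pi> v)) else {\<one>})" for r s v c \<pi>
    by (simp add: sdpp_factor_def)
  have tri0: "a \<otimes> inv a' \<otimes> (b \<otimes> inv b') = \<one>" if "tri G a a' b b' \<one> \<one> = \<one>"
      "a \<in> carrier G" "a' \<in> carrier G" "b \<in> carrier G" "b' \<in> carrier G" for a a' b b'
    using that by (simp add: tri_def)
  have tri1: "b \<otimes> inv b' \<otimes> (c \<otimes> inv c') = \<one>" if "tri G \<one> \<one> b b' c c' = \<one>"
      "b \<in> carrier G" "b' \<in> carrier G" "c \<in> carrier G" "c' \<in> carrier G" for b b' c c'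
    using that by (simp add: tri_def)
  have tri2: "c \<otimes> inv c' \<otimes> (a \<otimes> inv a') = \<one>" if "tri G a a' \<one> \<one> c c' = \<one>"
      "c \<in> carrier G" "c' \<in> carrier G" "a \<in> carrier G" "a' \<in> carrier G" for a a' c c'
    using that by (simp add: tri_def m_comm)
  {
    fix p1 p2 p3
    assume perm: "p1 \<in> {\<pi>. \<pi> permutes triangle_points n}" "p2 \<in> {\<pi>. \<pi> permutes triangle_points n}" "p3 \<in> {\<pi>. \<pi> permutes triangle_points n}"
      and ex: "\<And>w. w \<in> triangle_points n \<times> {0, 1, 2} \<Longrightarrow> \<exists>a\<in>sdpp_factor A B 0 2 w p1. \<exists>a'\<in>sdpp_factor A B 0 2 w p2.
        \<exists>b\<in>sdpp_factor A B 1 0 w p2. \<exists>b'\<in>sdpp_factor A B 1 0 w p3.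
        \<exists>c\<in>sdpp_factor A B 2 1 w p3. \<exists>c'\<in>sdpp_factor A B 2 1 w p1. tri G a a' b b' c c' = \<one>"
    show "p1 = p2 \<and> p2 = p3"
    proof (rule triangle_permutations_eq)
      fix v assume v: "v \<in> triangle_points n"
      note cos = co[OF _ v] and subs = sub(1)[OF co[OF _ v]] sub(2)[OF co[OF _ v]]
      have p: "p1 permutes triangle_points n" "p2 permutes triangle_points n" "p3 permutes triangle_points n" using perm by auto
      obtain a a' b b' where 0: "a \<in> A (coord 0 (p1 v))" "a' \<in> A (coord 0 (p2 v))" "b \<in> B (coord 0 (p2 v))"
        "b' \<in> B (coord 0 (p3 v))" "tri G a a' b b' \<one> \<one> = \<one>"
        using ex[of "(v, 0)"] v by (auto simp: simps)
      have "a \<otimes> inv a' \<otimes> (b \<otimes> inv b') = \<one>" using 0 p subs by (intro tri0) blast+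
      then show "coord 0 (p1 v) = coord 0 (p3 v)"
        by (rule sdppD(1)[OF sdpp cos[OF p(1)] cos[OF p(2)] cos[OF p(3)] 0(1-4)])
      obtain b b' c c' where 1: "b \<in> A (coord 1 (p2 v))" "b' \<in> A (coord 1 (p3 v))" "c \<in> B (coord 1 (p3 v))"
        "c' \<in> B (coord 1 (p1 v))" "tri G \<one> \<one> b b' c c' = \<one>"
        using ex[of "(v, 1)"] v by (auto simp: simps)
      have "b \<otimes> inv b' \<otimes> (c \<otimes> inv c') = \<one>" using 1 p subs by (intro tri1) blast+
      then show "coord 1 (p2 v) = coord 1 (p1 v)"
        by (rule sdppD(1)[OF sdpp cos[OF p(2)] cos[OF p(3)] cos[OF p(1)] 1(1-4)])
      obtain c c' a a' where 2: "c \<in> A (coord 2 (p3 v))" "c' \<in> A (coord 2 (p1 v))" "a \<in> B (coord 2 (p1 v))"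
        "a' \<in> B (coord 2 (p2 v))" "tri G a a' \<one> \<one> c c' = \<one>"
        using ex[of "(v, 2)"] v by (auto simp: simps)
      have "c \<otimes> inv c' \<otimes> (a \<otimes> inv a') = \<one>" using 2 p subs by (intro tri2) blast+
      then show "coord 2 (p3 v) = coord 2 (p2 v)"
        by (rule sdppD(1)[OF sdpp cos[OF p(3)] cos[OF p(1)] cos[OF p(2)] 2(1-4)])
    qed (use perm in auto)
  }
  fix p w a a' b b' c c'
  assume perm: "p \<in> {\<pi>. \<pi> permutes triangle_points n}" and w: "w \<in> triangle_points n \<times> {0, 1, 2}"
    and mem: "a \<in> sdpp_factor A B 0 2 w p" "a' \<in> sdpp_factor A B 0 2 w p" "b \<in> sdpp_factor A B 1 0 w p"
      "b' \<in> sdpp_factor A B 1 0 w p" "c \<in> sdpp_factor A B 2 1 w p" "c' \<in> sdpp_factor A B 2 1 w p"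
    and tri: "tri G a a' b b' c c' = \<one>"
  obtain v r where w': "w = (v, r)" "v \<in> triangle_points n" "r \<in> {0, 1, 2}" using w by auto
  have i: "coord r (p v) \<in> {1..n}" using co perm w' by auto
  have car: "a \<in> carrier G" "a' \<in> carrier G" "b \<in> carrier G" "b' \<in> carrier G" "c \<in> carrier G" "c' \<in> carrier G"
    using mem fsub[OF w perm] by auto
  consider "r = 0" | "r = 1" | "r = 2" using w' by blast
  then show "a = a' \<and> b = b' \<and> c = c'"
  proof cases
    case 1
    then show ?thesis using mem tri tri0 car sdppD(2)[OF sdpp i i i, of a a' b b'] by (auto simp: w' simps)
  next
    case 2
    then show ?thesis using mem tri tri1 car sdppD(2)[OF sdpp i i i, of b b' c c'] by (auto simp: w' simps)
  next
    case 3
    then show ?thesis using mem tri tri2 car sdppD(2)[OF sdpp i i i, of c c' a a'] by (auto simp: w' simps)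
  qed
qed

lemma card_sdpp_factors:
  assumes "\<pi> permutes triangle_points n" "r \<in> {0, 1, 2}" "s \<in> {0, 1, 2}" "r \<noteq> s"
  shows "card (\<Pi>\<^sub>E w\<in>triangle_points n \<times> {0, 1, 2}. sdpp_factor A B r s w \<pi>) =
    (\<Prod>v\<in>triangle_points n. card (A (coord r v)) * card (B (coord s v)))"
proof -
  have "card (\<Pi>\<^sub>E w\<in>triangle_points n \<times> {0, 1, 2}. sdpp_factor A B r s w \<pi>) =
      (\<Prod>w\<in>triangle_points n \<times> {0, 1, 2}. card (sdpp_factor A B r s w \<pi>))"
    by (intro card_PiE) (auto simp: finite_triangle_points)
  also have "\<dots> = (\<Prod>v\<in>triangle_points n. \<Prod>c\<in>{0, 1, 2}. card (sdpp_factor A B r s (v, c) \<pi>))"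
    by (subst prod.cartesian_product) (simp only: case_prod_unfold prod.collapse)
  also have "\<dots> = (\<Prod>v\<in>triangle_points n. card (A (coord r (\<pi> v))) * card (B (coord s (\<pi> v))))"
    using assms by (intro prod.cong refl) (auto simp: sdpp_factor_def)
  also have "\<dots> = (\<Prod>v\<in>triangle_points n. card (A (coord r v)) * card (B (coord s v)))"
    using prod.permute[OF assms(1), of "\<lambda>v. card (A (coord r v)) * card (B (coord s v))"] by (simp add: comp_def)
  finally show ?thesis .
qed

text \<open>The single-block inequality is used with \<open>g = order G ^ 3\<close>, one copy of
  \<open>G\<close> per coordinate, and \<open>t = s ^ 3\<close>.\<close>

lemma matmul_in_O_powr_of_sdpp:
  fixes \<sigma> \<tau> s :: real
  assumes fin: "finite (carrier G)" and sdpp: "simultaneous_double_product_property G n A B"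
    and s: "\<And>i. i \<in> {1..n} \<Longrightarrow> s \<le> real (card (A i) * card (B i))" "1 \<le> s"
    and "n \<ge> 1" and \<sigma>: "2 \<le> \<sigma>" "\<sigma> < \<tau>"
    and le: "real (order G) ^ 3 \<le> (real n)\<^sup>2 / 6 * s powr \<sigma>"
    and large: "s powr (\<tau> - \<sigma>) \<ge> 2"
  shows "matmul_in_O_powr \<tau>"
proof -
  let ?W = "triangle_points n \<times> {0, 1, 2 :: nat}" and ?M = "card (triangle_points n)"
  define P where "P r t = (\<Prod>v\<in>triangle_points n. card (A (coord r v)) * card (B (coord t v)))" for r t
  define V where "V = P 0 2 * P 1 0 * P 2 1"
  \<comment> \<open>Regrouped by coordinate, each \<open>A\<close> meets the \<open>B\<close> of the
    same index, so \<open>s\<close> bounds every factor.\<close>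
  have "real V = (\<Prod>v\<in>triangle_points n. (\<Prod>c\<in>{0, 1, 2}. real (card (A (coord c v)) * card (B (coord c v)))))"
    unfolding V_def P_def prod.distrib[symmetric] of_nat_prod by (intro prod.cong refl) (simp add: mult_ac)
  also have "\<dots> \<ge> (\<Prod>v\<in>triangle_points n. (\<Prod>c\<in>{0, 1, 2 :: nat}. s))"
    using s triangle_points_coord by (intro prod_mono conjI prod_nonneg) auto
  finally have V: "(s ^ 3) ^ ?M \<le> real V" by (simp add: power3_eq_cube mult.assoc)
  have M2: "2 * ?M = n * (n + 1)" by (simp add: card_triangle_points)
  then have "?M \<ge> 1" using \<open>n \<ge> 1\<close> by (cases ?M) auto
  have M: "real n ^ 2 / 2 \<le> real ?M"
  proof -
    have "real (2 * ?M) = real n * (real n + 1)" unfolding M2 by (simp add: algebra_simps)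
    then show ?thesis by (simp add: power2_eq_square algebra_simps)
  qed
  \<comment> \<open>The 6 in the hypothesis \<open>le\<close> comes from
    \<open>?M \<ge> n^2 / 2\<close> and \<open>e \<le> 3\<close>.\<close>
  have e: "exp 1 \<le> (3::real)" by (rule exp_le)
  have "(real n)\<^sup>2 / 6 = (real n ^ 2 / 2) / 3" by simp
  also have "\<dots> \<le> real ?M / exp 1" using M e by (intro frac_le) auto
  finally have h: "(real n)\<^sup>2 / 6 * s powr \<sigma> \<le> real ?M / exp 1 * s powr \<sigma>" by (intro mult_right_mono) auto
  have ps: "s powr \<sigma> = (s ^ 3) powr (\<sigma> / 3)" using s(2) by (simp add: powr_powr flip: powr_numeral)
  have le': "real (order G) ^ 3 \<le> real ?M / exp 1 * (s ^ 3) powr (\<sigma> / 3)"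
    using order_trans[OF le h] unfolding ps .
  have "(real (order G) ^ 3) ^ ?M \<le> fact ?M * real V powr (\<sigma> / 3)"
    using \<sigma> s(2) by (intro permutation_power_bound[OF _ _ _ le' V]) auto
  moreover have "card ?W = 3 * ?M" by (simp add: card_cartesian_product)
  then have "order (product_group ?W (\<lambda>_. G)) = (order G ^ 3) ^ ?M"
    by (simp only: order_power_group finite_cartesian_product finite_triangle_points finite.intros power_mult)
  ultimately have bound: "real (order (product_group ?W (\<lambda>_. G))) \<le>
      real (card {\<pi>. \<pi> permutes triangle_points n}) * real (P 0 2 * P 1 0 * P 2 1) powr (\<sigma> / 3)"
    by (simp add: card_permutations finite_triangle_points V_def)
  have fin': "finite (carrier (product_group ?W (\<lambda>_. G)))"
    using fin by (auto simp: finite_triangle_points intro!: finite_PiE)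
  have "s ^ 1 \<le> s ^ (3 * ?M)" using s(2) \<open>?M \<ge> 1\<close> by (intro power_increasing) auto
  then have "s \<le> real V" using V by (simp add: power_mult)
  then have "s powr (\<tau> - \<sigma>) \<le> real V powr (\<tau> - \<sigma>)" using \<sigma> s(2) by (intro powr_mono2) auto
  then have large': "2 \<le> real (P 0 2 * P 1 0 * P 2 1) powr (\<tau> - \<sigma>)" using large by (simp add: V_def)
  show ?thesis
  proof (rule comm_group.matmul_in_O_powr_of_stpp[OF comm_group_power fin' _ _ stpp_of_sdpp[OF sdpp] _ _ _ bound \<sigma> large'])
    show "finite {\<pi>. \<pi> permutes triangle_points n}" by (simp add: finite_permutations finite_triangle_points)
    show "{\<pi>. \<pi> permutes triangle_points n} \<noteq> {}" using permutes_id[of "triangle_points n"] by blast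
  qed (simp_all add: P_def card_sdpp_factors del: One_nat_def)
qed

end

lemma matmul_exponent_of_sdpp:
  fixes n :: "nat \<Rightarrow> nat" and H :: "nat \<Rightarrow> 'g monoid"
  assumes n: "strict_mono n" and e: "e \<longlonglongrightarrow> 0" "e' \<longlonglongrightarrow> 0"
    and H: "\<And>m. comm_group (H m)" "\<And>m. finite (carrier (H m))"
      "\<And>m. simultaneous_double_product_property (H m) (n m) (A m) (B m)"
      "\<And>m. real (card (carrier (H m))) = real (n m) powr (2 + e m)"
      "\<And>m i. i \<in> {1..n m} \<Longrightarrow> real (n m) powr (2 - e' m) \<le> real (card (A m i) * card (B m i))"
  shows "matmul_exponent = 2"
proof (rule matmul_exponent_eq_2)
  fix \<tau> :: real assume "\<tau> > 2"
  \<comment> \<open>In exponents of \<open>n m\<close>, the goal compares \<open>6 + 3 * e m\<close>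
    with \<open>2 + (2 - e' m) * (2 + \<delta>)\<close>, that is with
    \<open>6 + 2 * \<delta> - e' m * (2 + \<delta>)\<close>, up to a constant 6. One \<delta>
    absorbs the error terms, the other the constant, once
    \<open>n m \<ge> 6 powr (1 / \<delta>)\<close>.\<close>
  define \<delta> where "\<delta> = (\<tau> - 2) / 2"
  define \<sigma> where "\<sigma> = 2 + \<delta>"
  have \<sigma>: "\<delta> > 0" "2 \<le> \<sigma>" "\<sigma> < \<tau>" "\<tau> - \<sigma> = \<delta>" using \<open>\<tau> > 2\<close> by (auto simp: \<sigma>_def \<delta>_def field_simps)
  have nlim: "filterlim (\<lambda>m. real (n m)) at_top sequentially"
    by (rule filterlim_compose[OF filterlim_real_sequentially filterlim_subseq[OF n]])
  have 1: "\<forall>\<^sub>F m in sequentially. real (n m) \<ge> max 1 (6 powr (1 / \<delta>))"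
    using nlim unfolding filterlim_at_top by blast
  have "(\<lambda>m. 3 * e m + e' m * (2 + \<delta>)) \<longlonglongrightarrow> 3 * 0 + 0 * (2 + \<delta>)"
    by (intro tendsto_intros e)
  then have 2: "\<forall>\<^sub>F m in sequentially. 3 * e m + e' m * (2 + \<delta>) < \<delta>"
    using \<sigma>(1) by (intro order_tendstoD) auto
  \<comment> \<open>This keeps the lower bound \<open>n m powr (2 - e' m)\<close> on the sizes above
    \<open>n m\<close> itself, so its \<delta>-th power is at least 6 as well.\<close>
  have 3: "\<forall>\<^sub>F m in sequentially. e' m < 1" using e(2) by (intro order_tendstoD) auto
  obtain m where m: "real (n m) \<ge> max 1 (6 powr (1 / \<delta>))" "3 * e m + e' m * (2 + \<delta>) < \<delta>" "e' m < 1"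
    using eventually_happens'[OF sequentially_bot eventually_conj[OF 1 eventually_conj[OF 2 3]]] by blast
  interpret comm_group "H m" by (rule H(1))
  let ?x = "real (n m)"
  have x: "?x \<ge> 1" using m(1) by simp
  have "6 = (6 powr (1 / \<delta>)) powr \<delta>" using \<sigma>(1) by (simp add: powr_powr)
  also have "\<dots> \<le> ?x powr \<delta>" using m(1) \<sigma>(1) by (intro powr_mono2) auto
  finally have x\<delta>: "6 \<le> ?x powr \<delta>" .
  show "matmul_in_O_powr \<tau>"
  proof (rule matmul_in_O_powr_of_sdpp[OF H(2,3) H(5) _ _ \<sigma>(2,3)])
    show "1 \<le> ?x powr (2 - e' m)" using x m(3) by (intro ge_one_powr_ge_zero) auto
    show "1 \<le> n m" using x by simp
    have "real (order (H m)) ^ 3 = ?x powr ((2 + e m) * 3)"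
      using H(4)[of m] x by (simp add: order_def powr_powr flip: powr_numeral)
    moreover have "6 * ?x powr ((2 + e m) * 3) \<le> ?x powr \<delta> * ?x powr ((2 + e m) * 3)"
      using x\<delta> by (intro mult_right_mono) auto
    moreover have "\<dots> = ?x powr (\<delta> + (2 + e m) * 3)" by (simp add: powr_add)
    moreover have "\<dots> \<le> ?x powr (2 + (2 - e' m) * \<sigma>)"
      using m(2) x unfolding \<sigma>_def by (intro powr_mono) (auto simp: algebra_simps)
    moreover have "\<dots> = ?x\<^sup>2 * (?x powr (2 - e' m)) powr \<sigma>"
      using x by (simp add: powr_add powr_powr powr_numeral)
    ultimately show "real (order (H m)) ^ 3 \<le> ?x\<^sup>2 / 6 * (?x powr (2 - e' m)) powr \<sigma>" by simp
    have "2 \<le> ?x powr \<delta>" using x\<delta> by simp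
    also have "\<dots> \<le> (?x powr (2 - e' m)) powr \<delta>"
      using x m(3) \<sigma>(1) powr_mono[of 1 "2 - e' m" ?x] by (intro powr_mono2) auto
    finally show "2 \<le> (?x powr (2 - e' m)) powr (\<tau> - \<sigma>)" by (simp only: \<sigma>(4))
  qed
qed

theorem mainTheorem4:
  shows "(strong_USP_capacity = 3 / 2 powr (2 / 3) \<longrightarrow> matmul_exponent = 2) \<and>
    ((\<exists>(n :: nat \<Rightarrow> nat) (H :: nat \<Rightarrow> 'g monoid) A B (e :: nat \<Rightarrow> real) (e' :: nat \<Rightarrow> real).
        strict_mono n \<and> e \<longlonglongrightarrow> 0 \<and> e' \<longlonglongrightarrow> 0 \<and>
        (\<forall>m. comm_group (H m) \<and> finite (carrier (H m)) \<and>
          simultaneous_double_product_property (H m) (n m) (A m) (B m) \<and>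
          real (card (carrier (H m))) = real (n m) powr (2 + e m) \<and>
          (\<forall>i\<in>{1..n m}.
             real (card (A m i) * card (B m i)) \<ge> real (n m) powr (2 - e' m))))
      \<longrightarrow> matmul_exponent = 2)"
proof (intro conjI impI)
  assume "strong_USP_capacity = 3 / 2 powr (2 / 3)"
  then show "matmul_exponent = 2"
    using strong_USP_achievable_capacity matmul_exponent_of_capacity by simp
next
  assume "\<exists>(n :: nat \<Rightarrow> nat) (H :: nat \<Rightarrow> 'g monoid) A B (e :: nat \<Rightarrow> real) (e' :: nat \<Rightarrow> real).
        strict_mono n \<and> e \<longlonglongrightarrow> 0 \<and> e' \<longlonglongrightarrow> 0 \<and>
        (\<forall>m. comm_group (H m) \<and> finite (carrier (H m)) \<and>
          simultaneous_double_product_property (H m) (n m) (A m) (B m) \<and>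
          real (card (carrier (H m))) = real (n m) powr (2 + e m) \<and>
          (\<forall>i\<in>{1..n m}.
             real (card (A m i) * card (B m i)) \<ge> real (n m) powr (2 - e' m)))"
  then obtain n :: "nat \<Rightarrow> nat" and H :: "nat \<Rightarrow> 'g monoid" and A B and e e' :: "nat \<Rightarrow> real"
    where *: "strict_mono n" "e \<longlonglongrightarrow> 0" "e' \<longlonglongrightarrow> 0"
      "\<And>m. comm_group (H m) \<and> finite (carrier (H m)) \<and>
          simultaneous_double_product_property (H m) (n m) (A m) (B m) \<and>
          real (card (carrier (H m))) = real (n m) powr (2 + e m) \<and>
          (\<forall>i\<in>{1..n m}.
             real (card (A m i) * card (B m i)) \<ge> real (n m) powr (2 - e' m))"
    by blast
  show "matmul_exponent = 2"
    by (rule matmul_exponent_of_sdpp[OF *(1-3), of H A B]) (use *(4) in blast)+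
qed

end
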